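(* For each integer $N\ge 3$, the gap process $X=(X(t))_{t\ge 0}$, $X(t)=(X_1(t),\ldots,X_{N-2}(t))\in\mathbb{Z}_+^{N-2}$, of the $N$-counter system is a positive recurrent Markov chain, with a stationary distribution $\pi$.
   Context: The $N$-counter system: there are $N$ counters taking integer values. At every time step $t=0,1,2,\ldots$ an (unordered) pair of distinct counters is selected uniformly at random among the $\binom N2$ pairs, independently over steps. If the states of the two selected counters are different, the smaller one is increased by $1$; if they are equal, both are increased by $1$. It is assumed that the system starts from a configuration with at least two counters at the highest level; then at all times there are at least two counters at the highest level. Gap process: at each time order the counters from largest to smallest. For $j=1,\ldots,N-2$ let $X_j(t)\ge 0$ be the distance (difference of values) between the $(j+1)$-th largest and the $(j+2)$-th largest counter after $t$ steps. (The distance between the largest and second largest counter is always $0$.) The process $X(t)=(X_1(t),\ldots,X_{N-2}(t))$ is a time-homogeneous Markov chain on $\mathbb{Z}_+^{N-2}$, where $\mathbb{Z}_+=\{0,1,2,\ldots\}$. *)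

theory Defs
  imports "HOL-Probability.Probability"
begin

section \<open>Markov chains on a countable state space\<close>

text \<open>
  The process \<open>X\<close> on the probability space \<open>M\<close> is a time-homogeneous Markov chain with countable
  state space \<open>S\<close> and transition kernel \<open>K\<close>. The values of \<open>K\<close> outside \<open>S\<close> are irrelevant.
\<close>

definition markov_chain ::
  "'w measure \<Rightarrow> 's set \<Rightarrow> ('s \<Rightarrow> 's pmf) \<Rightarrow> (nat \<Rightarrow> 'w \<Rightarrow> 's) \<Rightarrow> bool" where
  "markov_chain M S K X \<longleftrightarrow>
     prob_space M \<and> countable S \<and>
     (\<forall>t. X t \<in> M \<rightarrow>\<^sub>M count_space S) \<and>
     (\<forall>x\<in>S. set_pmf (K x) \<subseteq> S) \<and>
     (\<forall>t x y. \<P>(\<omega> in M. \<forall>s\<le>t. X s \<omega> = x s) > 0 \<longrightarrow>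
        \<P>(\<omega> in M. X (Suc t) \<omega> = y \<bar> \<forall>s\<le>t. X s \<omega> = x s) = pmf (K (x t)) y)"

text \<open>The infimum is taken in the extended reals, so it is \<open>\<infinity>\<close> if \<open>x\<close> is never visited.\<close>

definition return_time :: "(nat \<Rightarrow> 'w \<Rightarrow> 's) \<Rightarrow> 's \<Rightarrow> 'w \<Rightarrow> ennreal" where
  "return_time X x \<omega> = (INF t\<in>{t. 1 \<le> t \<and> X t \<omega> = x}. of_nat t)"

text \<open>To be used for a chain \<open>X\<close> that starts in \<open>x\<close>.\<close>

definition positive_recurrent_at :: "'w measure \<Rightarrow> (nat \<Rightarrow> 'w \<Rightarrow> 's) \<Rightarrow> 's \<Rightarrow> bool" where
  "positive_recurrent_at M X x \<longleftrightarrow> (\<integral>\<^sup>+ \<omega>. return_time X x \<omega> \<partial>M) < \<infinity>"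

definition stationary_distribution :: "'s set \<Rightarrow> ('s \<Rightarrow> 's pmf) \<Rightarrow> 's pmf \<Rightarrow> bool" where
  "stationary_distribution S K \<pi> \<longleftrightarrow> set_pmf \<pi> \<subseteq> S \<and> bind_pmf \<pi> K = \<pi>"


section \<open>The counter system\<close>

text \<open>
  A configuration of \<open>N\<close> counters is a list of \<open>N\<close> integers, entry \<open>i\<close> being the value of
  counter \<open>i\<close>. At least two counters have the highest value.
\<close>

definition configs :: "nat \<Rightarrow> int list set" where
  "configs N = {c. length c = N \<and> 2 \<le> card {i. i < N \<and> c ! i = Max (set c)}}"

text \<open>The unordered pair of distinct counters \<open>{i, j}\<close> is represented by \<open>(i, j)\<close> with \<open>i < j\<close>.\<close>

definition selection_pmf :: "nat \<Rightarrow> (nat \<times> nat) pmf" where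
  "selection_pmf N = pmf_of_set {(i, j). i < j \<and> j < N}"

definition selections :: "nat \<Rightarrow> (nat \<Rightarrow> nat \<times> nat) measure" where
  "selections N = (\<Pi>\<^sub>M t\<in>UNIV. measure_pmf (selection_pmf N))"

fun step :: "nat \<times> nat \<Rightarrow> int list \<Rightarrow> int list" where
  "step (i, j) c =
     (if c ! i < c ! j then c[i := c ! i + 1]
      else if c ! j < c ! i then c[j := c ! j + 1]
      else c[i := c ! i + 1, j := c ! j + 1])"

fun counters :: "int list \<Rightarrow> nat \<Rightarrow> (nat \<Rightarrow> nat \<times> nat) \<Rightarrow> int list" where
  "counters c 0 \<omega> = c"
| "counters c (Suc t) \<omega> = step (\<omega> t) (counters c t \<omega>)"

text \<open>
  List indices start at 0: the \<open>(j+1)\<close>-th and \<open>(j+2)\<close>-th largest counters are the entries \<open>j\<close> and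
  \<open>j+1\<close> of the decreasingly sorted list, and \<open>j\<close> ranges over \<open>1, \<dots>, N - 2\<close> for \<open>N = length c\<close>.
  The difference is nonnegative, so \<open>nat\<close> does not truncate.
\<close>

definition gaps :: "int list \<Rightarrow> nat list" where
  "gaps c = (let s = rev (sort c) in map (\<lambda>j. nat (s ! j - s ! (j + 1))) [1..<length c - 1])"

definition gap_space :: "nat \<Rightarrow> nat list set" where
  "gap_space N = {x. length x = N - 2}"

definition gap_process :: "int list \<Rightarrow> nat \<Rightarrow> (nat \<Rightarrow> nat \<times> nat) \<Rightarrow> nat list" where
  "gap_process c t \<omega> = gaps (counters c t \<omega>)"

text \<open>Every element of the state space is the gap vector of some admissible configuration.\<close>

lemma gaps_surj:
  assumes "2 \<le> N" "x \<in> gap_space N"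
  shows "\<exists>c\<in>configs N. gaps c = x"
proof -
  define f :: "nat \<Rightarrow> int" where "f i = - int (\<Sum>k<i - 1. x ! k)" for i
  define c where "c = map f [0..<N]"
  have anti: "f j \<le> f i" if "i \<le> j" for i j
  proof -
    have "(\<Sum>k<i - 1. x ! k) \<le> (\<Sum>k<j - 1. x ! k)"
      using that by (intro sum_mono2) auto
    then show ?thesis unfolding f_def by linarith
  qed
  have len: "length c = N" "length x = N - 2"
    using assms(2) by (auto simp: c_def gap_space_def)
  have "sorted (rev c)"
    unfolding sorted_iff_nth_mono by (auto simp: c_def rev_nth intro!: anti)
  then have "sort c = rev c"
    by (metis mset_rev properties_for_sort)
  then have rs: "rev (sort c) = c" by simp
  have "gaps c = x"
  proof (rule nth_equalityI)
    fix i assume "i < length (gaps c)"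
    then have "i + 2 < N" using len by (auto simp: gaps_def Let_def)
    then show "gaps c ! i = x ! i"
      using len unfolding gaps_def rs Let_def by (simp add: c_def f_def)
  qed (use len in \<open>auto simp: gaps_def Let_def\<close>)
  moreover have "f 0 = 0" "f 1 = 0" by (auto simp: f_def)
  moreover have "Max (set c) = f 0"
    using assms(1) by (intro Max_eqI) (auto simp: c_def intro!: anti)
  ultimately have "{0, 1} \<subseteq> {i. i < N \<and> c ! i = Max (set c)}"
    using assms(1) by (auto simp: c_def)
  then have "card {0, 1 :: nat} \<le> card {i. i < N \<and> c ! i = Max (set c)}"
    by (intro card_mono) auto
  then show ?thesis
    using \<open>gaps c = x\<close> len by (auto simp: configs_def)
qed

end

theory Submission
  imports Defs
begin

text \<open>
  The quadratic function \<open>\<Sum>\<^sub>a\<^sub>,\<^sub>b (c\<^sub>a - c\<^sub>b)\<^sup>2\<close> is a Foster-Lyapunov function. Up to a bounded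
  second-order term, its mean increment is proportional to
  \<open>\<Sum>\<^sub>a\<^sub>,\<^sub>b (c\<^sub>a - c\<^sub>b) (\<delta>\<^sub>a - \<delta>\<^sub>b)\<close>, where \<open>\<delta>\<^sub>a\<close> counts the other counters at or above
  counter \<open>a\<close>; a strictly higher counter has a strictly smaller \<open>\<delta>\<close>, so this is at most
  \<open>- \<Sum>\<^sub>a\<^sub>,\<^sub>b \<bar>c\<^sub>a - c\<^sub>b\<bar>\<close> and the drift is negative outside finitely many gap vectors.
  All gap vectors communicate: raising the lower counters to the top leads to zero gaps, and any
  configuration is rebuilt from equal counters by undoing steps.
  To pass from the drift condition to a single state \<open>x\<close> without stopping times, one adds to the
  Lyapunov function a multiple of \<open>\<Sum>\<^sub>k\<^sub><\<^sub>m P\<^sub>y(no visit to x in steps 1, \<dots>, k)\<close>. The result \<open>W\<close>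
  satisfies \<open>W \<ge> 1 + K (1\<^bsub>\<noteq>x\<^esub> W)\<close> for the transition kernel \<open>K\<close> and therefore dominates the
  expected return time to \<open>x\<close>. The expected occupation measure of an excursion from \<open>x\<close> is then
  finite and, normalised, stationary.
\<close>

section \<open>Drift conditions and stationary distributions\<close>

text \<open>The probability that the chain started in \<open>y\<close> avoids \<open>x\<close> at
  times 1, ..., k. The start itself is not tested, so \<open>y = x\<close> gives the tail of the
  return time.\<close>

primrec survive :: "('s \<Rightarrow> 's pmf) \<Rightarrow> 's \<Rightarrow> nat \<Rightarrow> 's \<Rightarrow> ennreal" where
  "survive K x 0 y = 1"
| "survive K x (Suc k) y = (\<integral>\<^sup>+z. indicator (- {x}) z * survive K x k z \<partial>measure_pmf (K y))"

lemma survive_Suc_le: "survive K x (Suc k) y \<le> survive K x k y"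
proof (induction k arbitrary: y)
  case 0
  have "(\<integral>\<^sup>+z. indicator (- {x}) z * survive K x 0 z \<partial>measure_pmf (K y))
    \<le> (\<integral>\<^sup>+z. 1 \<partial>measure_pmf (K y))"
    by (intro nn_integral_mono) (auto split: split_indicator)
  then show ?case by simp
next
  case (Suc k)
  then show ?case
    by (subst (1 2) survive.simps(2)) (intro nn_integral_mono mult_left_mono, auto)
qed

lemma survive_antimono: "m \<le> n \<Longrightarrow> survive K x n y \<le> survive K x m y"
  by (rule lift_Suc_antimono_le[of "\<lambda>k. survive K x k y"]) (rule survive_Suc_le)

lemma survive_le_1: "survive K x k y \<le> 1"
  using survive_antimono[of 0 k K x y] by simp

lemma survive_less_top: "survive K x k y < top"
  using le_less_trans[OF survive_le_1 ennreal_one_less_top] .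

text \<open>Strictness at one atom is enough: were the integral 1, the nonnegative function
  \<open>1 - f\<close> would have integral 0 and hence vanish on the whole support.\<close>

lemma nn_integral_pmf_less_1:
  assumes "\<And>z. f z \<le> (1::ennreal)" "z \<in> set_pmf p" "f z < 1"
  shows "(\<integral>\<^sup>+z. f z \<partial>measure_pmf p) < 1"
proof (rule ccontr)
  assume "\<not> ?thesis"
  moreover have "(\<integral>\<^sup>+z. f z \<partial>measure_pmf p) \<le> (\<integral>\<^sup>+z. 1 \<partial>measure_pmf p)"
    using assms(1) by (intro nn_integral_mono) auto
  ultimately have eq: "(\<integral>\<^sup>+z. f z \<partial>measure_pmf p) = 1" by simp
  have "(\<integral>\<^sup>+z. 1 - f z \<partial>measure_pmf p) = (\<integral>\<^sup>+z. 1 \<partial>measure_pmf p) - (\<integral>\<^sup>+z. f z \<partial>measure_pmf p)"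
    using assms(1) eq by (intro nn_integral_diff) auto
  then have "(\<integral>\<^sup>+z. 1 - f z \<partial>measure_pmf p) = 0" using eq by simp
  then have "AE z in measure_pmf p. 1 - f z = 0"
    by (subst (asm) nn_integral_0_iff_AE) auto
  then have "1 - f z = 0" using assms(2) by (auto simp: AE_measure_pmf_iff)
  then show False using assms(3) by (simp add: diff_eq_0_iff_ennreal)
qed

definition transitions :: "('s \<Rightarrow> 's pmf) \<Rightarrow> ('s \<times> 's) set" where
  "transitions K = {(y, z). z \<in> set_pmf (K y)}"

text \<open>Induction backwards along a path into \<open>x\<close>: every transition on it has
  positive probability, so the loss of mass at \<open>x\<close> is passed back, at the cost of one
  more step each time.\<close>

lemma survive_less_1:
  assumes "(y, x) \<in> (transitions K)\<^sup>+"
  shows "\<exists>m. survive K x m y < 1"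
  using assms
proof (induction rule: converse_trancl_induct)
  case (base y)
  have "survive K x (Suc 0) y < 1"
    unfolding survive.simps
    by (rule nn_integral_pmf_less_1[of _ x])
      (use base in \<open>auto simp: transitions_def split: split_indicator\<close>)
  then show ?case by blast
next
  case (step y z)
  then obtain m where m: "survive K x m z < 1" by blast
  have "indicator (- {x}) w * survive K x m w \<le> survive K x m w" for w
    by (auto split: split_indicator)
  note le = order_trans[OF this survive_le_1] le_less_trans[OF this m]
  have "survive K x (Suc m) y < 1"
    unfolding survive.simps
    by (rule nn_integral_pmf_less_1[where f = "\<lambda>z. indicator (- {x}) z * survive K x m z", OF le(1) _ le(2)])
      (use step(1) in \<open>simp add: transitions_def\<close>)
  then show ?case by blast
qed

text \<open>Without the term in \<open>b\<close>, the drift bound can fail only on the finite set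
  \<open>C\<close>, where \<open>x\<close> is hit within \<open>m\<close> steps with probability at
  least \<open>e\<close>. The sum \<open>F\<close> of the first \<open>m\<close> survival
  probabilities never grows under the taboo kernel and drops by at least \<open>e\<close> on
  \<open>C\<close>, so a multiple of it absorbs the excess \<open>b\<close>.\<close>

lemma taboo_supersolution:
  fixes K :: "'s \<Rightarrow> 's pmf" and V :: "'s \<Rightarrow> ennreal"
  assumes fin: "finite C" and V: "\<And>y. V y < \<infinity>" and b: "b < \<infinity>"
    and drift: "\<And>y. y \<in> S \<Longrightarrow> (\<integral>\<^sup>+z. V z \<partial>measure_pmf (K y)) + 1 \<le> V y + b * indicator C y"
    and reach: "\<And>y. y \<in> C \<Longrightarrow> (y, x) \<in> (transitions K)\<^sup>+"
  obtains W :: "'s \<Rightarrow> ennreal" where "\<And>y. W y < \<infinity>"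
    and "\<And>y. y \<in> S \<Longrightarrow> 1 + (\<integral>\<^sup>+z. indicator (- {x}) z * W z \<partial>measure_pmf (K y)) \<le> W y"
proof -
  have "\<forall>y\<in>C. \<exists>m. survive K x m y < 1" using survive_less_1[OF reach] by blast
  then obtain mm where mm: "\<And>y. y \<in> C \<Longrightarrow> survive K x (mm y) y < 1" by metis
  \<comment> \<open>Survival decreases in time, so the largest of the finitely many horizons serves
    all of \<open>C\<close>; the inserted 0 covers empty \<open>C\<close>.\<close>
  define m where "m = Max (insert 0 (mm ` C))"
  have m: "survive K x m y < 1" if "y \<in> C" for y
    using survive_antimono[of "mm y" m K x y] mm[OF that] that fin
    by (auto simp: m_def intro: le_less_trans)
  \<comment> \<open>The smallest hitting probability on \<open>C\<close>; the inserted 1 covers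
    empty \<open>C\<close> and yields \<open>e \<le> 1\<close>.\<close>
  define e where "e = Min (insert 1 ((\<lambda>y. 1 - survive K x m y) ` C))"
  have "e \<in> insert 1 ((\<lambda>y. 1 - survive K x m y) ` C)"
    unfolding e_def by (rule Min_in) (use fin in auto)
  then have e0: "e > 0" using m by (auto simp: diff_gr0_ennreal)
  have e1: "e \<le> 1" unfolding e_def using fin by (intro Min_le) auto
  have e: "survive K x m y + e * indicator C y \<le> 1" for y
  proof (cases "y \<in> C")
    case True
    then have "e \<le> 1 - survive K x m y" unfolding e_def using fin by (intro Min_le) auto
    then have "survive K x m y + e \<le> survive K x m y + (1 - survive K x m y)"
      by (intro add_left_mono)
    also have "\<dots> = 1" using survive_le_1[of K x m y] by (simp add: add_diff_inverse_ennreal)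
    finally show ?thesis using True by simp
  qed (simp add: survive_le_1)
  define F where "F y = (\<Sum>k<m. survive K x k y)" for y
  have Ffin: "F y < \<infinity>" for y
    by (simp add: F_def survive_less_top)
  define PF where "PF y = (\<integral>\<^sup>+z. indicator (- {x}) z * F z \<partial>measure_pmf (K y))" for y
  have PF: "PF y + e * indicator C y \<le> F y" for y
  proof -
    have "PF y = (\<Sum>k<m. survive K x (Suc k) y)"
      unfolding PF_def F_def sum_distrib_left survive.simps by (rule nn_integral_sum) simp
    \<comment> \<open>Both sides are the sum of the survival probabilities over k = 0, ..., m, split
      off at the first and at the last index.\<close>
    then have "1 + PF y = F y + survive K x m y"
      unfolding F_def using sum.lessThan_Suc[of "\<lambda>k. survive K x k y" m]
        sum.lessThan_Suc_shift[of "\<lambda>k. survive K x k y" m] by simp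
    moreover have "survive K x m y + (PF y + e * indicator C y) \<le> 1 + PF y"
      using add_right_mono[OF e[of y], of "PF y"] by (simp add: ac_simps)
    ultimately have "survive K x m y + (PF y + e * indicator C y) \<le> survive K x m y + F y"
      by (simp add: ac_simps)
    then show ?thesis using survive_less_top[of K x m y] by (auto simp: ennreal_add_left_cancel_le)
  qed
  \<comment> \<open>Chosen so that the gain \<open>a * e\<close> on \<open>C\<close> is exactly the
    excess \<open>b\<close>.\<close>
  define a where "a = b / e"
  have ae: "a * e = b" 
    using e0 e1 unfolding a_def
    by (metis ennreal_divide_times ennreal_divide_self ennreal_one_less_top le_less_trans mult.right_neutral neq_iff)
  have afin: "a < \<infinity>"
    using e0 b unfolding a_def by (auto simp: ennreal_divide_eq_top_iff less_top[symmetric])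
  define W where "W y = V y + a * F y" for y
  have "W y < \<infinity>" for y
    using V[of y] Ffin[of y] afin by (simp add: W_def ennreal_mult_less_top)
  moreover have "1 + (\<integral>\<^sup>+z. indicator (- {x}) z * W z \<partial>measure_pmf (K y)) \<le> W y" if "y \<in> S" for y
  proof -
    have "(\<integral>\<^sup>+z. indicator (- {x}) z * W z \<partial>measure_pmf (K y))
      = (\<integral>\<^sup>+z. indicator (- {x}) z * V z \<partial>measure_pmf (K y)) + a * PF y"
      unfolding W_def PF_def
      by (simp add: distrib_left nn_integral_add nn_integral_cmult[symmetric] mult.left_commute)
    also have "(\<integral>\<^sup>+z. indicator (- {x}) z * V z \<partial>measure_pmf (K y)) \<le> (\<integral>\<^sup>+z. V z \<partial>measure_pmf (K y))"
      by (intro nn_integral_mono) (auto split: split_indicator)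
    finally have "1 + (\<integral>\<^sup>+z. indicator (- {x}) z * W z \<partial>measure_pmf (K y))
      \<le> (\<integral>\<^sup>+z. V z \<partial>measure_pmf (K y)) + 1 + a * PF y"
      by (simp add: ac_simps add_left_mono)
    also have "\<dots> \<le> V y + b * indicator C y + a * PF y"
      by (intro add_right_mono drift that)
    also have "\<dots> = V y + a * (PF y + e * indicator C y)"
      by (simp add: ae[symmetric] distrib_left ac_simps)
    also have "\<dots> \<le> W y"
      unfolding W_def by (intro add_left_mono mult_left_mono PF) auto
    finally show ?thesis .
  qed
  ultimately show thesis by (rule that)
qed

section \<open>The occupation measure of an excursion\<close>

text \<open>The probability that the chain started in \<open>x\<close> is in \<open>z\<close> at
  time k without having returned to \<open>x\<close> at times 1, ..., k: the forward counterpart of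
  \<open>survive\<close>.\<close>

primrec taboo_mass :: "('s \<Rightarrow> 's pmf) \<Rightarrow> 's \<Rightarrow> nat \<Rightarrow> 's \<Rightarrow> ennreal" where
  "taboo_mass K x 0 z = indicator {x} z"
| "taboo_mass K x (Suc k) z =
     indicator (- {x}) z * (\<integral>\<^sup>+y. taboo_mass K x k y * pmf (K y) z \<partial>count_space UNIV)"

lemma taboo_mass_support:
  assumes "x \<in> S" and closed: "\<And>y. y \<in> S \<Longrightarrow> set_pmf (K y) \<subseteq> S" and "z \<notin> S"
  shows "taboo_mass K x k z = 0"
  using \<open>z \<notin> S\<close>
proof (induction k arbitrary: z)
  case (Suc k)
  have "taboo_mass K x k y * pmf (K y) z = 0" for y
    using Suc closed[of y] by (cases "y \<in> S") (auto simp: pmf_eq_0_set_pmf)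
  then have "(\<integral>\<^sup>+y. taboo_mass K x k y * pmf (K y) z \<partial>count_space UNIV) = 0"
    by (simp only: nn_integral_const mult_zero_left)
  then show ?case by simp
qed (use assms in \<open>auto split: split_indicator\<close>)

text \<open>Duality between the action of \<open>K\<close> on functions and on measures, by Tonelli
  for counting measures.\<close>

lemma nn_integral_kernel_swap:
  fixes K :: "'s \<Rightarrow> 's pmf"
  shows "(\<integral>\<^sup>+y. f y * (\<integral>\<^sup>+z. g z \<partial>measure_pmf (K y)) \<partial>count_space UNIV)
    = (\<integral>\<^sup>+z. g z * (\<integral>\<^sup>+y. f y * pmf (K y) z \<partial>count_space UNIV) \<partial>count_space UNIV)"
proof -
  have "(\<integral>\<^sup>+y. f y * (\<integral>\<^sup>+z. g z \<partial>measure_pmf (K y)) \<partial>count_space UNIV)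
    = (\<integral>\<^sup>+y. \<integral>\<^sup>+z. f y * (pmf (K y) z * g z) \<partial>count_space UNIV \<partial>count_space UNIV)"
    by (simp add: nn_integral_measure_pmf nn_integral_cmult)
  also have "\<dots> = (\<integral>\<^sup>+z. \<integral>\<^sup>+y. f y * (pmf (K y) z * g z) \<partial>count_space UNIV \<partial>count_space UNIV)"
    using nn_integral_fst_count_space[of "\<lambda>(y, z). f y * (pmf (K y) z * g z)"]
      nn_integral_snd_count_space[of "\<lambda>(y, z). f y * (pmf (K y) z * g z)"] by simp
  also have "\<dots> = (\<integral>\<^sup>+z. g z * (\<integral>\<^sup>+y. f y * pmf (K y) z \<partial>count_space UNIV) \<partial>count_space UNIV)"
    by (simp add: nn_integral_cmult[symmetric] ac_simps)
  finally show ?thesis .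
qed

text \<open>The bound telescopes: the mass alive at time n plus the expected \<open>W\<close> at
  time n + 1 is at most the expected \<open>W\<close> at time n. Dropping the last term bounds the
  expected length of an excursion by \<open>W x\<close>.\<close>

lemma taboo_mass_total:
  assumes "x \<in> S" "\<And>y. y \<in> S \<Longrightarrow> set_pmf (K y) \<subseteq> S"
    and W: "\<And>y. y \<in> S \<Longrightarrow> 1 + (\<integral>\<^sup>+z. indicator (- {x}) z * W z \<partial>measure_pmf (K y)) \<le> W y"
  shows "(\<Sum>k<n. \<integral>\<^sup>+y. taboo_mass K x k y \<partial>count_space UNIV)
    + (\<integral>\<^sup>+y. taboo_mass K x n y * W y \<partial>count_space UNIV) \<le> W x"
proof (induction n)
  case 0
  have "(\<integral>\<^sup>+y. taboo_mass K x 0 y * W y \<partial>count_space UNIV)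
      = (\<integral>\<^sup>+y. W x * indicator {x} y \<partial>count_space UNIV)"
    by (intro nn_integral_cong) (auto split: split_indicator)
  then show ?case by (simp add: nn_integral_cmult_indicator)
next
  case (Suc n)
  have "(\<integral>\<^sup>+y. taboo_mass K x n y \<partial>count_space UNIV)
      + (\<integral>\<^sup>+y. taboo_mass K x (Suc n) y * W y \<partial>count_space UNIV)
    = (\<integral>\<^sup>+y. taboo_mass K x n y \<partial>count_space UNIV)
      + (\<integral>\<^sup>+z. indicator (- {x}) z * W z *
          (\<integral>\<^sup>+y. taboo_mass K x n y * pmf (K y) z \<partial>count_space UNIV) \<partial>count_space UNIV)"
    by (simp add: ac_simps)
  also have "\<dots> = (\<integral>\<^sup>+y. taboo_mass K x n y *
      (1 + (\<integral>\<^sup>+z. indicator (- {x}) z * W z \<partial>measure_pmf (K y))) \<partial>count_space UNIV)"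
    by (simp add: nn_integral_kernel_swap[symmetric] distrib_left nn_integral_add)
  also have "\<dots> \<le> (\<integral>\<^sup>+y. taboo_mass K x n y * W y \<partial>count_space UNIV)"
  proof (intro nn_integral_mono)
    fix y
    show "taboo_mass K x n y * (1 + (\<integral>\<^sup>+z. indicator (- {x}) z * W z \<partial>measure_pmf (K y)))
      \<le> taboo_mass K x n y * W y"
      \<comment> \<open>The inequality for \<open>W\<close> is known on \<open>S\<close> only;
        elsewhere the taboo mass is 0.\<close>
      using W[of y] taboo_mass_support[OF assms(1,2), where z = y and k = n]
      by (cases "y \<in> S") (auto intro: mult_left_mono)
  qed
  finally have "(\<Sum>k<Suc n. \<integral>\<^sup>+y. taboo_mass K x k y \<partial>count_space UNIV)
      + (\<integral>\<^sup>+y. taboo_mass K x (Suc n) y * W y \<partial>count_space UNIV)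
    \<le> (\<Sum>k<n. \<integral>\<^sup>+y. taboo_mass K x k y \<partial>count_space UNIV)
      + (\<integral>\<^sup>+y. taboo_mass K x n y * W y \<partial>count_space UNIV)"
    by (simp add: add.assoc add_left_mono)
  then show ?case using Suc by (rule order_trans)
qed

text \<open>\<open>\<nu>\<close> counts the expected visits during an excursion from
  \<open>x\<close>, with the start counted and the return not. Its total mass \<open>Z\<close> is
  the expected excursion length, at most \<open>W x\<close>, and \<open>\<nu> / Z\<close> is the
  stationary law.\<close>

lemma stationary_distribution_exists:
  fixes K :: "'s \<Rightarrow> 's pmf"
  assumes xS: "x \<in> S" and closed: "\<And>y. y \<in> S \<Longrightarrow> set_pmf (K y) \<subseteq> S"
    and Wfin: "W x < \<infinity>"
    and W: "\<And>y. y \<in> S \<Longrightarrow> 1 + (\<integral>\<^sup>+z. indicator (- {x}) z * W z \<partial>measure_pmf (K y)) \<le> W y"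
  shows "\<exists>\<pi>. stationary_distribution S K \<pi>"
proof -
  define \<nu> where "\<nu> z = (\<Sum>k. taboo_mass K x k z)" for z
  define \<mu> where "\<mu> z = (\<integral>\<^sup>+y. \<nu> y * pmf (K y) z \<partial>count_space UNIV)" for z
  define Z where "Z = (\<integral>\<^sup>+y. \<nu> y \<partial>count_space UNIV)"
  have "Z = (\<Sum>k. \<integral>\<^sup>+y. taboo_mass K x k y \<partial>count_space UNIV)"
    unfolding Z_def \<nu>_def by (simp add: nn_integral_suminf)
  also have "\<dots> \<le> W x"
  proof (rule suminf_le_const)
    show "(\<Sum>k<n. \<integral>\<^sup>+y. taboo_mass K x k y \<partial>count_space UNIV) \<le> W x" for n
      by (rule order_trans[OF _ taboo_mass_total[OF xS closed W, of n]]) auto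
  qed auto
  finally have Zfin: "Z < \<infinity>" using Wfin by (rule le_less_trans)
  have \<nu>x: "\<nu> x = 1"
  proof -
    have "\<nu> x = (\<Sum>k\<in>{0}. taboo_mass K x k x)"
      unfolding \<nu>_def
    proof (rule suminf_finite)
      show "taboo_mass K x k x = 0" if "k \<notin> {0}" for k using that by (cases k) auto
    qed simp
    then show ?thesis by simp
  qed
  have split: "(\<integral>\<^sup>+y. f y \<partial>count_space UNIV)
      = f x + (\<integral>\<^sup>+y. indicator (- {x}) y * f y \<partial>count_space UNIV)" for f :: "'s \<Rightarrow> ennreal"
  proof -
    have "(\<integral>\<^sup>+y. f y \<partial>count_space UNIV)
      = (\<integral>\<^sup>+y. f x * indicator {x} y + indicator (- {x}) y * f y \<partial>count_space UNIV)"
      by (intro nn_integral_cong) (auto split: split_indicator)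
    also have "\<dots> = f x + (\<integral>\<^sup>+y. indicator (- {x}) y * f y \<partial>count_space UNIV)"
      by (simp add: nn_integral_add nn_integral_cmult_indicator)
    finally show ?thesis .
  qed
  \<comment> \<open>Applying \<open>K\<close> advances the excursion by one step; the time-0 term
    that is lost in this shift lives at \<open>x\<close> only.\<close>
  have off: "\<mu> z = \<nu> z" if "z \<noteq> x" for z
  proof -
    have "\<mu> z = (\<integral>\<^sup>+y. (\<Sum>k. taboo_mass K x k y * pmf (K y) z) \<partial>count_space UNIV)"
      unfolding \<mu>_def \<nu>_def by simp
    also have "\<dots> = (\<Sum>k. \<integral>\<^sup>+y. taboo_mass K x k y * pmf (K y) z \<partial>count_space UNIV)"
      by (rule nn_integral_suminf) simp
    also have "\<dots> = (\<Sum>k. taboo_mass K x (Suc k) z)" using that by simp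
    also have "\<dots> = (\<Sum>k. taboo_mass K x (k + 1) z) + (\<Sum>k<1. taboo_mass K x k z)"
      using that by simp
    also have "\<dots> = \<nu> z" unfolding \<nu>_def by (rule suminf_offset[symmetric]) simp
    finally show ?thesis .
  qed
  \<comment> \<open>Balance at \<open>x\<close> comes for free: \<open>\<nu>\<close> and its image \<open>\<mu>\<close> have the same finite total mass.\<close>
  have "(\<integral>\<^sup>+z. \<mu> z \<partial>count_space UNIV) = Z"
    using nn_integral_kernel_swap[of \<nu> K "\<lambda>_. 1"] by (simp add: \<mu>_def Z_def)
  moreover have "(\<integral>\<^sup>+y. indicator (- {x}) y * \<mu> y \<partial>count_space UNIV)
      = (\<integral>\<^sup>+y. indicator (- {x}) y * \<nu> y \<partial>count_space UNIV)"
    using off by (intro nn_integral_cong) (auto split: split_indicator)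
  ultimately have "(\<integral>\<^sup>+y. indicator (- {x}) y * \<nu> y \<partial>count_space UNIV) + \<mu> x
     = (\<integral>\<^sup>+y. indicator (- {x}) y * \<nu> y \<partial>count_space UNIV) + \<nu> x"
    using split[of \<mu>] split[of \<nu>] by (simp add: Z_def add.commute)
  moreover have "(\<integral>\<^sup>+y. indicator (- {x}) y * \<nu> y \<partial>count_space UNIV) < \<infinity>"
    using Zfin split[of \<nu>] unfolding Z_def by (auto simp: less_top[symmetric])
  ultimately have "\<mu> x = \<nu> x" by (auto simp: ennreal_add_left_cancel)
  then have inv: "\<mu> z = \<nu> z" for z using off by (cases "z = x") auto

  have "Z > 0" unfolding Z_def using split[of \<nu>] \<nu>x by (simp add: add_pos_nonneg)
  define f where "f z = \<nu> z / Z" for z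
  have f1: "(\<integral>\<^sup>+z. f z \<partial>count_space UNIV) = 1"
    unfolding f_def using \<open>Z > 0\<close> Zfin
    by (simp add: nn_integral_divide Z_def[symmetric] ennreal_divide_self)
  have ffin: "f z < \<infinity>" for z
  proof -
    have "f z = (\<integral>\<^sup>+y. f z * indicator {z} y \<partial>count_space UNIV)"
      by (simp add: nn_integral_cmult_indicator)
    also have "\<dots> \<le> (\<integral>\<^sup>+z. f z \<partial>count_space UNIV)"
      by (intro nn_integral_mono) (auto split: split_indicator)
    finally show ?thesis using f1 by (auto simp: less_top[symmetric] top_unique)
  qed
  define \<pi> where "\<pi> = embed_pmf (\<lambda>z. enn2real (f z))"
  have fe: "ennreal (enn2real (f z)) = f z" for z using ffin by (simp add: less_top)
  have pmf: "ennreal (pmf \<pi> z) = f z" for z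
    unfolding \<pi>_def by (subst pmf_embed_pmf) (auto simp: fe f1)
  have "bind_pmf \<pi> K = \<pi>"
  proof (rule pmf_eqI)
    fix z
    have "ennreal (pmf (bind_pmf \<pi> K) z) = (\<integral>\<^sup>+y. f y * pmf (K y) z \<partial>count_space UNIV)"
      by (simp add: ennreal_pmf_bind nn_integral_measure_pmf pmf)
    also have "\<dots> = (\<integral>\<^sup>+y. (\<nu> y * pmf (K y) z) / Z \<partial>count_space UNIV)"
      unfolding f_def by (simp add: divide_ennreal_def ac_simps)
    also have "\<dots> = f z"
      by (simp add: nn_integral_divide \<mu>_def[symmetric] inv f_def)
    also have "\<dots> = ennreal (pmf \<pi> z)" by (simp add: pmf)
    finally show "pmf (bind_pmf \<pi> K) z = pmf \<pi> z" by (simp add: pmf_nonneg)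
  qed
  moreover have "set_pmf \<pi> \<subseteq> S"
  proof
    fix z assume z: "z \<in> set_pmf \<pi>"
    show "z \<in> S"
    proof (rule ccontr)
      assume "z \<notin> S"
      then have "\<nu> z = 0" unfolding \<nu>_def by (simp add: taboo_mass_support[OF xS closed])
      then have "pmf \<pi> z = 0" using pmf[of z] by (simp add: f_def)
      then show False using z by (simp add: set_pmf_iff)
    qed
  qed
  ultimately show ?thesis unfolding stationary_distribution_def by blast
qed


section \<open>Lumping configurations to gap vectors\<close>

definition pairs :: "nat \<Rightarrow> (nat \<times> nat) set" where
  "pairs N = {(i, j). i < j \<and> j < N}"

lemma finite_pairs: "finite (pairs N)"
  by (rule finite_subset[of _ "{..<N} \<times> {..<N}"]) (auto simp: pairs_def)

lemma pairs_nonempty: "N \<ge> 2 \<Longrightarrow> pairs N \<noteq> {}"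
proof -
  assume "N \<ge> 2"
  then have "(0, 1) \<in> pairs N" by (simp add: pairs_def)
  then show ?thesis by blast
qed

lemma selection_pmf_pairs: "selection_pmf N = pmf_of_set (pairs N)"
  by (simp add: selection_pmf_def pairs_def)

lemma set_selection_pmf: "N \<ge> 2 \<Longrightarrow> set_pmf (selection_pmf N) = pairs N"
  by (simp add: selection_pmf_pairs finite_pairs pairs_nonempty)

text \<open>One non-strict comparison covers both branches of the rule: a selected counter moves iff
  it does not exceed its partner, so a tie moves both.\<close>

definition raised :: "int list \<Rightarrow> nat \<times> nat \<Rightarrow> nat \<Rightarrow> bool" where
  "raised c p a \<longleftrightarrow> (a = fst p \<and> c ! a \<le> c ! snd p) \<or> (a = snd p \<and> c ! a \<le> c ! fst p)"

text \<open>Normal form of an unordered pair, so that a choice given in any order becomes an element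
  of \<open>pairs N\<close>.\<close>

definition order_pair :: "nat \<times> nat \<Rightarrow> nat \<times> nat" where
  "order_pair p = (min (fst p) (snd p), max (fst p) (snd p))"

lemma order_pair_in_pairs: "i < N \<Longrightarrow> j < N \<Longrightarrow> i \<noteq> j \<Longrightarrow> order_pair (i, j) \<in> pairs N"
  by (auto simp: order_pair_def pairs_def)

lemma raised_order_pair:
  "raised c (order_pair (i, j)) a \<longleftrightarrow> (a = i \<and> c ! a \<le> c ! j) \<or> (a = j \<and> c ! a \<le> c ! i)"
  by (auto simp: order_pair_def raised_def min_def max_def)

lemma length_step [simp]: "length (step p c) = length c"
  by (cases p) auto

lemma nth_step:
  assumes "p \<in> pairs (length c)" "a < length c"
  shows "step p c ! a = c ! a + of_bool (raised c p a)"
  using assms by (cases p) (auto simp: pairs_def raised_def nth_list_update)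

lemma configsD:
  assumes "c \<in> configs N"
  shows "length c = N"
    and "\<exists>i j. i < N \<and> j < N \<and> i \<noteq> j \<and> c ! i = c ! j \<and> (\<forall>a<N. c ! a \<le> c ! i)"
proof -
  show len: "length c = N" using assms by (simp add: configs_def)
  have "\<not> card {i. i < N \<and> c ! i = Max (set c)} \<le> Suc 0"
    using assms by (simp add: configs_def)
  then obtain i j where "i < N" "j < N" "i \<noteq> j" "c ! i = Max (set c)" "c ! j = Max (set c)"
    by (subst (asm) card_le_Suc0_iff_eq) auto
  then show "\<exists>i j. i < N \<and> j < N \<and> i \<noteq> j \<and> c ! i = c ! j \<and> (\<forall>a<N. c ! a \<le> c ! i)"
    using len by (intro exI[of _ i] exI[of _ j]) auto
qed

lemma configsI:
  assumes "length c = N" "i < N" "j < N" "i \<noteq> j" "c ! i = c ! j" "\<And>a. a < N \<Longrightarrow> c ! a \<le> c ! i"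
  shows "c \<in> configs N"
proof -
  have "Max (set c) = c ! i"
    using assms by (intro Max_eqI) (auto simp: in_set_conv_nth)
  then have "{i, j} \<subseteq> {i. i < N \<and> c ! i = Max (set c)}" using assms by auto
  then have "card {i, j} \<le> card {i. i < N \<and> c ! i = Max (set c)}"
    by (intro card_mono) auto
  then show ?thesis using assms by (simp add: configs_def)
qed

text \<open>If both selected counters are at the top, they form the new top pair. Otherwise every
  raised counter was strictly below the top, so the old top pair stays put and is not
  overtaken.\<close>

lemma step_configs:
  assumes c: "c \<in> configs N" and p: "p \<in> pairs N"
  shows "step p c \<in> configs N"
proof -
  note len = configsD(1)[OF c]
  obtain i j where ij: "i < N" "j < N" "i \<noteq> j" "c ! i = c ! j" and max: "\<And>a. a < N \<Longrightarrow> c ! a \<le> c ! i"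
    using configsD(2)[OF c] by blast
  obtain k l where kl: "fst p = k" "snd p = l" "k < l" "l < N" using p by (auto simp: pairs_def)
  note nth = nth_step[of p c, unfolded len, OF p]
  have kN: "k < N" using kl by simp
  have max': "c ! a \<le> c ! i + 1" if "a < N" for a using max[OF that] by simp
  show ?thesis
  proof (cases "c ! k = c ! i \<and> c ! l = c ! i")
    case True
    show ?thesis
      by (rule configsI[of _ _ k l])
        (use True max max' kl kN len in \<open>auto simp: nth raised_def\<close>)
  next
    case False
    have "\<not> raised c p a \<or> c ! a < c ! i" if "a < N" for a
      using False max[of k] max[of l] kl kN by (auto simp: raised_def)
    then have "step p c ! a \<le> c ! i" if "a < N" for a
      using max[of a] nth[OF that] that by fastforce
    moreover have "step p c ! i = c ! i" "step p c ! j = c ! i"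
      using False max[of k] max[of l] kl kN ij by (auto simp: nth raised_def)
    ultimately show ?thesis
      using ij len by (intro configsI[of _ _ i j]) auto
  qed
qed

section \<open>Gap vectors as configurations up to relabelling and shift\<close>

lemma length_gaps: "length (gaps c) = length c - 2"
  by (simp add: gaps_def Let_def)

lemma gaps_in_gap_space: "c \<in> configs N \<Longrightarrow> gaps c \<in> gap_space N"
  by (simp add: gap_space_def length_gaps configs_def)

lemma sorted_desc_nth: "i \<le> j \<Longrightarrow> j < length c \<Longrightarrow> rev (sort c) ! j \<le> rev (sort c) ! i"
  for c :: "int list"
  by (simp add: rev_nth sorted_nth_mono)

text \<open>Of two distinct counters at the top level at least one is sorted to a position other
  than 0, so position 1 already carries the maximum.\<close>

lemma sorted_desc_top:
  assumes c: "c \<in> configs N"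
  shows "rev (sort c) ! 1 = rev (sort c) ! 0"
proof -
  note len = configsD(1)[OF c]
  obtain i j where ij: "i < N" "j < N" "i \<noteq> j" "c ! i = c ! j" and max: "\<And>a. a < N \<Longrightarrow> c ! a \<le> c ! i"
    using configsD(2)[OF c] by blast
  have "mset (rev (sort c)) = mset c" by simp
  then obtain \<sigma> where \<sigma>: "\<sigma> permutes {..<N}" "permute_list \<sigma> (rev (sort c)) = c"
    using len by (metis mset_eq_permutation length_rev length_sort)
  have nth: "c ! a = rev (sort c) ! \<sigma> a" if "a < N" for a
    using \<sigma> len permute_list_nth[of \<sigma> "rev (sort c)" a] that by auto
  have s: "\<sigma> i < N" "\<sigma> j < N" "\<sigma> i \<noteq> \<sigma> j"
    using \<sigma>(1) ij permutes_in_image[OF \<sigma>(1)] by (auto simp: permutes_def dest: injD[OF permutes_inj[OF \<sigma>(1)]])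
  have N2: "1 < N" using ij by linarith
  have "rev (sort c) ! 0 \<le> c ! i"
  proof -
    have "rev (sort c) ! 0 \<in> set c" using nth_mem[of 0 "rev (sort c)"] len N2 by simp
    then show ?thesis using max len by (metis in_set_conv_nth)
  qed
  moreover have "c ! i \<le> rev (sort c) ! 1"
  proof -
    have "1 \<le> \<sigma> i \<or> 1 \<le> \<sigma> j" using s by linarith
    then show ?thesis using sorted_desc_nth[of 1 "\<sigma> i" c] sorted_desc_nth[of 1 "\<sigma> j" c] s nth ij len by metis
  qed
  ultimately show ?thesis using sorted_desc_nth[of 0 1 c] len N2 by simp
qed

lemma gaps_nth:
  assumes "k < length c - 2"
  shows "int (gaps c ! k) = rev (sort c) ! (k + 1) - rev (sort c) ! (k + 2)"
  using assms sorted_desc_nth[of "k + 1" "k + 2" c] by (simp add: gaps_def Let_def)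

lemma configs_gaps_eq:
  assumes c: "c \<in> configs N" and d: "d \<in> configs N" and eq: "gaps c = gaps d"
  obtains k \<sigma> where "\<sigma> permutes {..<N}" "\<And>a. a < N \<Longrightarrow> d ! a = c ! \<sigma> a + k"
proof -
  note len = configsD(1)[OF c] configsD(1)[OF d]
  define k where "k = rev (sort d) ! 0 - rev (sort c) ! 0"
  have shift: "rev (sort d) ! a = rev (sort c) ! a + k" if "a < N" for a
    using that
  proof (induction a rule: less_induct)
    case (less a)
    \<comment> \<open>Gap \<open>b\<close> links the sorted positions \<open>b + 1\<close> and
      \<open>b + 2\<close>; position 1 is tied to position 0 by the two top counters.\<close>
    consider "a = 0" | "a = 1" | b where "a = b + 2" by (metis One_nat_def Suc_1 add_2_eq_Suc' old.nat.exhaust)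
    then show ?case
    proof cases
      case 3
      then have "b < N - 2" using less.prems by simp
      with 3 show ?thesis
        using gaps_nth[of b c] gaps_nth[of b d] eq less.IH[of "b + 1"] less.prems len by simp
    qed (use sorted_desc_top[OF c] sorted_desc_top[OF d] in \<open>auto simp: k_def\<close>)
  qed
  have "rev (sort d) = map (\<lambda>z. z + k) (rev (sort c))"
    using shift len by (intro nth_equalityI) auto
  then have "mset d = mset (map (\<lambda>z. z + k) (rev (sort c)))" by (metis mset_rev mset_sort)
  also have "\<dots> = mset (map (\<lambda>z. z + k) c)" by simp
  finally obtain \<sigma> where \<sigma>: "\<sigma> permutes {..<length (map (\<lambda>z. z + k) c)}"
      "permute_list \<sigma> (map (\<lambda>z. z + k) c) = d"
    by (rule mset_eq_permutation)
  have "d ! a = c ! \<sigma> a + k" if "a < N" for a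
    using \<sigma> len that permute_list_nth[OF \<sigma>(1), of a] permutes_in_image[OF \<sigma>(1), of a] by auto
  with \<sigma>(1) len show thesis by (intro that[of \<sigma> k]) auto
qed

text \<open>Sorting forgets labels and commutes with a shift, and differences cancel the
  shift.\<close>

lemma gaps_permute_shift:
  assumes \<sigma>: "\<sigma> permutes {..<N}" and len: "length c = N" "length d = N"
    and nth: "\<And>a. a < N \<Longrightarrow> d ! a = c ! \<sigma> a + k"
  shows "gaps d = gaps c"
proof -
  have "permute_list \<sigma> (map (\<lambda>z. z + k) c) = d"
    using \<sigma> len nth permute_list_nth[of \<sigma> "map (\<lambda>z. z + k) c"] permutes_in_image[OF \<sigma>]
    by (intro nth_equalityI) auto
  then have "mset d = mset (map (\<lambda>z. z + k) c)" using \<sigma> len by (metis length_map mset_permute_list)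
  also have "\<dots> = mset (map (\<lambda>z. z + k) (sort c))" by simp
  finally have m: "mset d = mset (map (\<lambda>z. z + k) (sort c))" .
  have "sorted (map (\<lambda>z. z + k) (sort c))"
    by (auto simp: sorted_iff_nth_mono intro!: sorted_nth_mono[OF sorted_sort])
  with m have "sort d = map (\<lambda>z. z + k) (sort c)" by (metis properties_for_sort)
  then have "rev (sort d) ! a = rev (sort c) ! a + k" if "a < N" for a
    using that len by (simp add: rev_map)
  then show ?thesis using len by (auto simp: gaps_def Let_def)
qed

text \<open>The rule only compares values, so a step commutes with relabelling and shift, and
  relabelling permutes the unordered pairs, preserving their uniform law. Hence the law of the next
  gap vector depends on the present gap vector alone.\<close>

lemma gap_kernel_lumps:
  assumes c: "c \<in> configs N" and d: "d \<in> configs N" and eq: "gaps c = gaps d" and N: "N \<ge> 2"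
  shows "map_pmf (\<lambda>p. gaps (step p d)) (selection_pmf N) = map_pmf (\<lambda>p. gaps (step p c)) (selection_pmf N)"
proof -
  obtain k \<sigma> where \<sigma>: "\<sigma> permutes {..<N}" and nth: "\<And>a. a < N \<Longrightarrow> d ! a = c ! \<sigma> a + k"
    using configs_gaps_eq[OF c d eq] by blast
  note len = configsD(1)[OF c] configsD(1)[OF d]
  have s: "\<sigma> a < N" if "a < N" for a using permutes_in_image[OF \<sigma>, of a] that by simp
  have inj: "\<sigma> a = \<sigma> b \<longleftrightarrow> a = b" for a b using permutes_inj[OF \<sigma>] by (auto dest: injD)
  \<comment> \<open>Transports a selection in \<open>d\<close> to the matching selection in
    \<open>c\<close>.\<close>
  define f where "f p = order_pair (map_prod \<sigma> \<sigma> p)" for p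
  have fp: "f p \<in> pairs N" if "p \<in> pairs N" for p
    using that s order_pair_in_pairs[of "\<sigma> (fst p)" N "\<sigma> (snd p)"]
    by (cases p) (simp add: f_def pairs_def inj)
  have "inj_on f (pairs N)"
  proof (rule inj_onI)
    fix p q assume pq: "p \<in> pairs N" "q \<in> pairs N" "f p = f q"
    then have "{\<sigma> (fst p), \<sigma> (snd p)} = {\<sigma> (fst q), \<sigma> (snd q)}"
      by (auto simp: f_def order_pair_def min_def max_def split: if_splits)
    then have "{fst p, snd p} = {fst q, snd q}" by (auto simp: doubleton_eq_iff inj)
    then show "p = q" using pq(1,2) by (auto simp: pairs_def doubleton_eq_iff)
  qed
  moreover have "f ` pairs N = pairs N"
    using fp calculation finite_pairs by (intro endo_inj_surj) auto
  ultimately have "bij_betw f (pairs N) (pairs N)" by (simp add: bij_betw_def)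
  then have f: "map_pmf f (selection_pmf N) = selection_pmf N"
    unfolding selection_pmf_pairs using N by (intro map_pmf_of_set_bij_betw finite_pairs pairs_nonempty)
  have "gaps (step p d) = gaps (step (f p) c)" if p: "p \<in> pairs N" for p
  proof (rule gaps_permute_shift[OF \<sigma>])
    fix a assume a: "a < N"
    have "raised d p a \<longleftrightarrow> raised c (f p) (\<sigma> a)"
      using p a nth by (auto simp: raised_def f_def order_pair_def pairs_def inj min_def max_def)
    then show "step p d ! a = step (f p) c ! \<sigma> a + k"
      using nth_step[of p d a] nth_step[of "f p" c "\<sigma> a"] p fp[OF p] a s[OF a] len nth[OF a] by simp
  qed (use len in auto)
  then have "map_pmf (\<lambda>p. gaps (step p d)) (selection_pmf N) = map_pmf (\<lambda>p. gaps (step (f p) c)) (selection_pmf N)"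
    using N by (intro map_pmf_cong) (auto simp: set_selection_pmf)
  also have "\<dots> = map_pmf (\<lambda>p. gaps (step p c)) (map_pmf f (selection_pmf N))"
    by (simp add: map_pmf_comp)
  finally show ?thesis by (simp add: f)
qed


section \<open>Drift and irreducibility\<close>

definition spread :: "int list \<Rightarrow> int" where
  "spread c = (\<Sum>a<length c. \<Sum>b<length c. (c ! a - c ! b)\<^sup>2)"

definition dispersion :: "int list \<Rightarrow> int" where
  "dispersion c = (\<Sum>a<length c. \<Sum>b<length c. \<bar>c ! a - c ! b\<bar>)"

lemma spread_nonneg: "0 \<le> spread c"
  by (simp add: spread_def sum_nonneg)

lemma spread_gaps_cong:
  assumes c: "c \<in> configs N" and d: "d \<in> configs N" and eq: "gaps c = gaps d"
  shows "spread d = spread c"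
proof -
  obtain k \<sigma> where \<sigma>: "\<sigma> permutes {..<N}" and nth: "\<And>a. a < N \<Longrightarrow> d ! a = c ! \<sigma> a + k"
    using configs_gaps_eq[OF c d eq] by blast
  have "spread d = (\<Sum>a<N. \<Sum>b<N. (c ! \<sigma> a - c ! \<sigma> b)\<^sup>2)"
    using nth configsD(1)[OF d] by (simp add: spread_def)
  also have "\<dots> = (\<Sum>a<N. \<Sum>b<N. (c ! \<sigma> a - c ! b)\<^sup>2)"
  proof (rule sum.cong[OF refl])
    fix a
    show "(\<Sum>b<N. (c ! \<sigma> a - c ! \<sigma> b)\<^sup>2) = (\<Sum>b<N. (c ! \<sigma> a - c ! b)\<^sup>2)"
      using sum.permute[OF \<sigma>, of "\<lambda>b. (c ! \<sigma> a - c ! b)\<^sup>2"] by (simp add: o_def)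
  qed
  also have "\<dots> = spread c"
    using configsD(1)[OF c] sum.permute[OF \<sigma>, of "\<lambda>a. \<Sum>b<N. (c ! a - c ! b)\<^sup>2"]
    by (simp add: spread_def o_def)
  finally show ?thesis .
qed

text \<open>A pair raising \<open>a\<close> is determined by its other member, which has to be at or
  above \<open>a\<close>.\<close>

lemma card_raising_pairs:
  assumes "a < N"
  shows "card {p \<in> pairs N. raised c p a} = card {b. b < N \<and> b \<noteq> a \<and> c ! a \<le> c ! b}"
proof (rule bij_betw_same_card[symmetric], rule bij_betwI')
  fix b b' assume "b \<in> {b. b < N \<and> b \<noteq> a \<and> c ! a \<le> c ! b}" "b' \<in> {b. b < N \<and> b \<noteq> a \<and> c ! a \<le> c ! b}"
  then show "order_pair (a, b) = order_pair (a, b') \<longleftrightarrow> b = b'"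
    by (auto simp: order_pair_def min_def max_def split: if_splits)
next
  fix b assume "b \<in> {b. b < N \<and> b \<noteq> a \<and> c ! a \<le> c ! b}"
  then show "order_pair (a, b) \<in> {p \<in> pairs N. raised c p a}"
    using assms by (auto simp: order_pair_in_pairs raised_order_pair)
next
  fix p assume "p \<in> {p \<in> pairs N. raised c p a}"
  then obtain i j where p: "p = (i, j)" "i < j" "j < N" "raised c (i, j) a" by (auto simp: pairs_def)
  then consider "a = i" "c ! i \<le> c ! j" | "a = j" "c ! j \<le> c ! i" by (auto simp: raised_def)
  then show "\<exists>b\<in>{b. b < N \<and> b \<noteq> a \<and> c ! a \<le> c ! b}. p = order_pair (a, b)"
  proof cases
    case 1
    then show ?thesis using p by (intro bexI[of _ j]) (auto simp: order_pair_def)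
  next
    case 2
    then show ?thesis using p by (intro bexI[of _ i]) (auto simp: order_pair_def)
  qed
qed

text \<open>Every partner that raises the higher counter \<open>a\<close> also raises
  \<open>b\<close>, and \<open>a\<close> itself is one more partner for \<open>b\<close>.\<close>

lemma card_raising_pairs_less:
  assumes "a < N" "b < N" "c ! b < c ! a"
  shows "card {p \<in> pairs N. raised c p a} < card {p \<in> pairs N. raised c p b}"
proof -
  have "card (insert a {x. x < N \<and> x \<noteq> a \<and> c ! a \<le> c ! x}) \<le> card {x. x < N \<and> x \<noteq> b \<and> c ! b \<le> c ! x}"
    using assms by (intro card_mono) auto
  then show ?thesis using assms by (simp add: card_raising_pairs)
qed

text \<open>Summing over the selections instead of averaging keeps the estimate in the integers; the
  division by the number of pairs is left to \<open>potential_drift\<close>.\<close>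

lemma sum_spread_step_le:
  assumes N: "length c = N"
  shows "(\<Sum>p\<in>pairs N. spread (step p c))
    \<le> int (card (pairs N)) * (spread c + int N ^ 2) - 2 * dispersion c"
proof -
  define r :: "nat \<times> nat \<Rightarrow> nat \<Rightarrow> int" where "r p a = of_bool (raised c p a)" for p a
  define \<delta> where "\<delta> a = int (card {p \<in> pairs N. raised c p a})" for a
  have \<delta>: "(\<Sum>p\<in>pairs N. r p a) = \<delta> a" for a
    unfolding r_def \<delta>_def using finite_pairs by (simp add: of_bool_def sum.If_cases Int_def)
  have "spread (step p c)
      \<le> spread c + int N ^ 2 + 2 * (\<Sum>a<N. \<Sum>b<N. (c ! a - c ! b) * (r p a - r p b))"
    if p: "p \<in> pairs N" for p
  proof -
    have "spread (step p c) = (\<Sum>a<N. \<Sum>b<N. (c ! a + r p a - (c ! b + r p b))\<^sup>2)"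
      using nth_step[of p c] p N by (simp add: spread_def r_def)
    also have "\<dots> \<le> (\<Sum>a<N. \<Sum>b<N. (c ! a - c ! b)\<^sup>2 + 1 + 2 * ((c ! a - c ! b) * (r p a - r p b)))"
    proof (intro sum_mono)
      fix a b
      \<comment> \<open>Increments are 0 or 1, so each of the \<open>N ^ 2\<close> second-order
        terms is at most 1.\<close>
      have "(r p a - r p b)\<^sup>2 \<le> 1" by (auto simp: r_def)
      then show "(c ! a + r p a - (c ! b + r p b))\<^sup>2
          \<le> (c ! a - c ! b)\<^sup>2 + 1 + 2 * ((c ! a - c ! b) * (r p a - r p b))"
        by (simp add: power2_eq_square algebra_simps)
    qed
    also have "\<dots> = spread c + int N ^ 2 + 2 * (\<Sum>a<N. \<Sum>b<N. (c ! a - c ! b) * (r p a - r p b))"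
      using N by (simp add: sum.distrib spread_def sum_distrib_left power2_eq_square)
    finally show ?thesis .
  qed
  then have "(\<Sum>p\<in>pairs N. spread (step p c)) \<le> (\<Sum>p\<in>pairs N. spread c + int N ^ 2
      + 2 * (\<Sum>a<N. \<Sum>b<N. (c ! a - c ! b) * (r p a - r p b)))"
    by (rule sum_mono)
  also have "\<dots> = int (card (pairs N)) * (spread c + int N ^ 2)
      + 2 * (\<Sum>p\<in>pairs N. \<Sum>a<N. \<Sum>b<N. (c ! a - c ! b) * (r p a - r p b))"
    by (simp add: sum.distrib sum_distrib_left distrib_left)
  also have "(\<Sum>p\<in>pairs N. \<Sum>a<N. \<Sum>b<N. (c ! a - c ! b) * (r p a - r p b))
      = (\<Sum>a<N. \<Sum>b<N. \<Sum>p\<in>pairs N. (c ! a - c ! b) * (r p a - r p b))"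
    by (subst sum.swap, rule sum.cong[OF refl], rule sum.swap)
  also have "\<dots> = (\<Sum>a<N. \<Sum>b<N. (c ! a - c ! b) * (\<delta> a - \<delta> b))"
    by (simp add: sum_distrib_left[symmetric] sum_subtractf \<delta>)
  \<comment> \<open>Whenever \<open>c ! a - c ! b\<close> is nonzero, the integer
    \<open>\<delta> a - \<delta> b\<close> has the opposite sign and modulus at least 1.\<close>
  also have "\<dots> \<le> (\<Sum>a<N. \<Sum>b<N. - \<bar>c ! a - c ! b\<bar>)"
  proof (intro sum_mono)
    fix a b assume "a \<in> {..<N}" "b \<in> {..<N}"
    then have "c ! b < c ! a \<Longrightarrow> \<delta> a - \<delta> b \<le> - 1" "c ! a < c ! b \<Longrightarrow> \<delta> a - \<delta> b \<ge> 1"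
      using card_raising_pairs_less[of a N b c] card_raising_pairs_less[of b N a c]
      by (auto simp: \<delta>_def)
    then show "(c ! a - c ! b) * (\<delta> a - \<delta> b) \<le> - \<bar>c ! a - c ! b\<bar>"
      using mult_left_mono[of "\<delta> a - \<delta> b" "- 1" "c ! a - c ! b"]
        mult_left_mono_neg[of 1 "\<delta> a - \<delta> b" "c ! a - c ! b"]
      by (cases "c ! a" "c ! b" rule: linorder_cases) auto
  qed
  also have "\<dots> = - dispersion c" using N by (simp add: dispersion_def sum_negf)
  finally show ?thesis by simp
qed

text \<open>A gap is the difference of two counter values, hence at most one summand of the
  dispersion. Thus a single large gap forces a strong drift.\<close>

lemma gap_le_dispersion:
  assumes "k < length c - 2"
  shows "int (gaps c ! k) \<le> dispersion c"
proof -
  have "rev (sort c) ! (k + 1) \<in> set c" "rev (sort c) ! (k + 2) \<in> set c"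
    using nth_mem[of "k + 1" "rev (sort c)"] nth_mem[of "k + 2" "rev (sort c)"] assms by auto
  then obtain a b where ab: "a < length c" "b < length c"
      "rev (sort c) ! (k + 1) = c ! a" "rev (sort c) ! (k + 2) = c ! b"
    by (metis in_set_conv_nth)
  have "int (gaps c ! k) \<le> \<bar>c ! a - c ! b\<bar>" using gaps_nth[OF assms] ab by simp
  also have "\<dots> \<le> (\<Sum>b<length c. \<bar>c ! a - c ! b\<bar>)"
    using ab by (intro member_le_sum) auto
  also have "\<dots> \<le> dispersion c"
    unfolding dispersion_def using ab
    by (intro member_le_sum[of a "{..<length c}" "\<lambda>a. \<Sum>b<length c. \<bar>c ! a - c ! b\<bar>"] sum_nonneg) auto
  finally show ?thesis .
qed

section \<open>Communication of all gap vectors\<close>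

text \<open>A move may start from any configuration with the given gaps, so paths can be built
  without fixing representatives.\<close>

definition gap_moves :: "nat \<Rightarrow> (nat list \<times> nat list) set" where
  "gap_moves N = {(gaps c, gaps (step p c)) | c p. c \<in> configs N \<and> p \<in> pairs N}"

lemma gap_movesI: "c \<in> configs N \<Longrightarrow> p \<in> pairs N \<Longrightarrow> (gaps c, gaps (step p c)) \<in> gap_moves N"
  unfolding gap_moves_def by blast

lemma gaps_constant:
  assumes "length c = N" "\<And>a. a < N \<Longrightarrow> c ! a = L"
  shows "gaps c = replicate (N - 2) 0"
proof (rule nth_equalityI)
  fix k assume k: "k < length (gaps c)"
  have "rev (sort c) ! x = L" if "x < N" for x
  proof -
    have "rev (sort c) ! x \<in> set c" using nth_mem[of x "rev (sort c)"] that assms by simp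
    then show ?thesis using assms by (metis in_set_conv_nth)
  qed
  then have "int (gaps c ! k) = 0" using gaps_nth[of k c] k assms by (simp add: length_gaps)
  then show "gaps c ! k = replicate (N - 2) 0 ! k" using k assms by (simp add: length_gaps)
qed (use assms in \<open>simp add: length_gaps\<close>)

text \<open>Selecting a low counter together with a top one raises only the low one and keeps the
  level \<open>L\<close>, so the total deficit below \<open>L\<close> decreases until all counters
  are equal.\<close>

lemma gap_moves_to_zero:
  assumes "c \<in> configs N" "i < N" "c ! i = L" "\<And>a. a < N \<Longrightarrow> c ! a \<le> L"
  shows "(gaps c, replicate (N - 2) 0) \<in> (gap_moves N)\<^sup>*"
  using assms
proof (induction "nat (\<Sum>a<N. L - c ! a)" arbitrary: c rule: less_induct)
  case less
  note len = configsD(1)[OF less.prems(1)]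
  show ?case
  proof (cases "\<forall>a<N. c ! a = L")
    case True
    then have "gaps c = replicate (N - 2) 0" using gaps_constant[of c N L] len by simp
    then show ?thesis by simp
  next
    case False
    then obtain b where b: "b < N" "c ! b < L" using less.prems(4) by fastforce
    define p where "p = order_pair (b, i)"
    have p: "p \<in> pairs N" using b less.prems by (auto simp: p_def intro: order_pair_in_pairs)
    have nth: "step p c ! a = c ! a + of_bool (a = b)" if "a < N" for a
      using nth_step[of p c a] p that len b less.prems(3) by (auto simp: p_def raised_order_pair)
    have "(\<Sum>a<N. L - step p c ! a) < (\<Sum>a<N. L - c ! a)"
      using b by (intro sum_strict_mono_ex1) (auto simp: nth intro!: bexI[of _ b])
    moreover have "0 \<le> (\<Sum>a<N. L - step p c ! a)"
      using less.prems(4) b by (intro sum_nonneg) (auto simp: nth)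
    moreover have "i \<noteq> b" using b less.prems(3) by auto
    ultimately have "(gaps (step p c), replicate (N - 2) 0) \<in> (gap_moves N)\<^sup>*"
      using less.prems b step_configs[OF less.prems(1) p]
      by (intro less.hyps) (auto simp: nth)
    moreover have "(gaps c, gaps (step p c)) \<in> gap_moves N"
      by (rule gap_movesI[OF less.prems(1) p])
    ultimately show ?thesis by (rule converse_rtrancl_into_rtrancl[rotated])
  qed
qed

text \<open>The path is built from its end: undoing a step lowers top counters and stays above the
  fixed floor \<open>m\<close>, so the total excess over \<open>m\<close> decreases until all
  counters are equal.\<close>

lemma gap_moves_from_zero:
  assumes "c \<in> configs N" "\<And>a. a < N \<Longrightarrow> m \<le> c ! a"
  shows "(replicate (N - 2) 0, gaps c) \<in> (gap_moves N)\<^sup>*"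
  using assms
proof (induction "nat (\<Sum>a<N. c ! a - m)" arbitrary: c rule: less_induct)
  case less
  note len = configsD(1)[OF less.prems(1)]
  obtain i j where ij: "i < N" "j < N" "i \<noteq> j" "c ! i = c ! j" and max: "\<And>a. a < N \<Longrightarrow> c ! a \<le> c ! i"
    using configsD(2)[OF less.prems(1)] by blast
  have via: ?case
    if I: "I \<noteq> {}" "I \<subseteq> {..<N}" and gt: "\<And>a. a \<in> I \<Longrightarrow> m < c ! a"
      and len': "length c' = N" and nth: "\<And>a. a < N \<Longrightarrow> c' ! a = c ! a - of_bool (a \<in> I)"
      and c': "c' \<in> configs N" and p: "p \<in> pairs N" and stepc: "step p c' = c" for I c' p
  proof -
    have "(\<Sum>a<N. c' ! a - m) < (\<Sum>a<N. c ! a - m)"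
      using I by (intro sum_strict_mono_ex1) (auto simp: nth subset_eq)
    moreover have le: "m \<le> c' ! a" if "a < N" for a
      using less.prems(2)[OF that] gt[of a] that by (auto simp: nth)
    moreover have "0 \<le> (\<Sum>a<N. c' ! a - m)" by (intro sum_nonneg) (auto simp: le)
    ultimately have "(replicate (N - 2) 0, gaps c') \<in> (gap_moves N)\<^sup>*"
      by (intro less.hyps c') auto
    moreover have "(gaps c', gaps c) \<in> gap_moves N"
      using gap_movesI[OF c' p] stepc by simp
    ultimately show ?thesis by (rule rtrancl_into_rtrancl)
  qed
  show ?case
  proof (cases "\<forall>a<N. c ! a = c ! i")
    case True
    then have "gaps c = replicate (N - 2) 0" using gaps_constant[of c N "c ! i"] len by simp
    then show ?thesis by simp
  next
    case False
    then obtain b where b: "b < N" "c ! b < c ! i" using max by fastforce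
    then have mi: "m < c ! i" using less.prems(2)[of b] by simp
    show ?thesis
    proof (cases "\<exists>k<N. k \<noteq> i \<and> k \<noteq> j \<and> c ! k = c ! i")
      case True
      then obtain k where k: "k < N" "k \<noteq> i" "k \<noteq> j" "c ! k = c ! i" by blast
      \<comment> \<open>With a third counter at the top, lowering it alone keeps \<open>i\<close>
        and \<open>j\<close> as top pair, and selecting it with \<open>i\<close> restores
        it.\<close>
      define c' where "c' = c[k := c ! k - 1]"
      have nth: "c' ! a = c ! a - of_bool (a \<in> {k})" if "a < N" for a
        using that len by (auto simp: c'_def nth_list_update)
      have len': "length c' = N" by (simp add: c'_def len)
      have p: "order_pair (k, i) \<in> pairs N" using k ij by (intro order_pair_in_pairs)
      have "c' \<in> configs N"
        using ij k len' by (intro configsI[of _ _ i j]) (auto simp: nth intro: max[unfolded ij])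
      moreover have "step (order_pair (k, i)) c' = c"
        using len' len p k ij
        by (intro nth_equalityI) (auto simp: nth_step nth raised_order_pair)
      ultimately show ?thesis
        using k mi len' nth p by (intro via[of "{k}" c']) auto
    next
      case False
      \<comment> \<open>With exactly two top counters all others are strictly lower, so after
        lowering both these are still a top pair, and selecting them raises both by the tie
        rule.\<close>
      define c' where "c' = c[i := c ! i - 1, j := c ! j - 1]"
      have nth: "c' ! a = c ! a - of_bool (a \<in> {i, j})" if "a < N" for a
        using that len ij by (auto simp: c'_def nth_list_update)
      have len': "length c' = N" by (simp add: c'_def len)
      have p: "order_pair (i, j) \<in> pairs N" using ij by (intro order_pair_in_pairs)
      have "c ! a < c ! i" if "a < N" "a \<noteq> i" "a \<noteq> j" for a
        using False max[of a] that by fastforce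
      then have "c' \<in> configs N"
        using ij len' by (intro configsI[of _ _ i j]) (auto simp: nth)
      moreover have "step (order_pair (i, j)) c' = c"
        using len' len p ij
        by (intro nth_equalityI) (auto simp: nth_step nth raised_order_pair)
      ultimately show ?thesis
        using ij mi len' nth p by (intro via[of "{i, j}" c']) auto
    qed
  qed
qed

lemma gap_moves_irreducible:
  assumes N: "N \<ge> 2" and xy: "x \<in> gap_space N" "y \<in> gap_space N"
  shows "(y, x) \<in> (gap_moves N)\<^sup>+"
proof -
  have to: "(gaps c, replicate (N - 2) 0) \<in> (gap_moves N)\<^sup>*" if "c \<in> configs N" for c
    using configsD(2)[OF that] gap_moves_to_zero[OF that] by blast
  have from_zero: "(replicate (N - 2) 0, gaps c) \<in> (gap_moves N)\<^sup>*" if "c \<in> configs N" for c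
    using configsD(1)[OF that] by (intro gap_moves_from_zero[OF that, of "Min (set c)"]) auto
  obtain c d where c: "c \<in> configs N" "gaps c = x" and d: "d \<in> configs N" "gaps d = y"
    using gaps_surj[OF N] xy by metis
  obtain p where p: "p \<in> pairs N" using pairs_nonempty[OF N] by blast
  \<comment> \<open>An arbitrary first move makes the path nonempty, which matters for
    \<open>x = y\<close>.\<close>
  have "(y, gaps (step p d)) \<in> gap_moves N" using gap_movesI[OF d(1) p] d by simp
  moreover have "(gaps (step p d), x) \<in> (gap_moves N)\<^sup>*"
    using to[OF step_configs[OF d(1) p]] from_zero[OF c(1)] c by simp
  ultimately show ?thesis by (rule rtrancl_into_trancl2)
qed


section \<open>The gap process as a Markov chain\<close>

text \<open>For gap vectors in \<open>gap_space N\<close> the choice affects neither the kernel nor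
  the potential, by \<open>gap_kernel_lumps\<close> and \<open>spread_gaps_cong\<close>.\<close>

definition representative :: "nat \<Rightarrow> nat list \<Rightarrow> int list" where
  "representative N y = (SOME c. c \<in> configs N \<and> gaps c = y)"

definition gap_kernel :: "nat \<Rightarrow> nat list \<Rightarrow> nat list pmf" where
  "gap_kernel N y = map_pmf (\<lambda>p. gaps (step p (representative N y))) (selection_pmf N)"

definition potential :: "nat \<Rightarrow> nat list \<Rightarrow> ennreal" where
  "potential N y = ennreal (of_int (spread (representative N y)))"

lemma representative:
  assumes "c \<in> configs N"
  shows "representative N (gaps c) \<in> configs N" "gaps (representative N (gaps c)) = gaps c"
  using someI[of "\<lambda>d. d \<in> configs N \<and> gaps d = gaps c" c] assms
  by (auto simp: representative_def)

lemma gap_kernel_gaps: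
  assumes "N \<ge> 2" "c \<in> configs N"
  shows "gap_kernel N (gaps c) = map_pmf (\<lambda>p. gaps (step p c)) (selection_pmf N)"
  unfolding gap_kernel_def
  using assms representative[OF assms(2)] by (intro gap_kernel_lumps) auto

lemma potential_gaps: "c \<in> configs N \<Longrightarrow> potential N (gaps c) = ennreal (of_int (spread c))"
  unfolding potential_def using representative[of c N] spread_gaps_cong[of c N "representative N (gaps c)"] by simp

lemma gap_kernel_closed:
  assumes "N \<ge> 2" "y \<in> gap_space N"
  shows "set_pmf (gap_kernel N y) \<subseteq> gap_space N"
proof -
  obtain c where c: "c \<in> configs N" "gaps c = y" using gaps_surj[OF assms] by blast
  then show ?thesis
    using gap_kernel_gaps[OF assms(1) c(1)] assms(1)
    by (auto simp: set_selection_pmf intro: gaps_in_gap_space step_configs)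
qed

lemma gap_moves_transitions:
  assumes "N \<ge> 2"
  shows "gap_moves N \<subseteq> transitions (gap_kernel N)"
  using assms
  by (auto simp: gap_moves_def transitions_def gap_kernel_gaps set_selection_pmf simp del: step.simps)

text \<open>Beyond this bound one gap alone makes the mean decrease
  \<open>2 * dispersion c / card (pairs N)\<close> at least \<open>N ^ 2 + 1\<close>, which pays for
  the second-order term and the required drift of 1.\<close>

definition small_gaps :: "nat \<Rightarrow> nat list set" where
  "small_gaps N = {y. length y = N - 2 \<and> set y \<subseteq> {..card (pairs N) * (N\<^sup>2 + 1)}}"

lemma finite_small_gaps: "finite (small_gaps N)"
  unfolding small_gaps_def using finite_lists_length_eq[of "{..card (pairs N) * (N\<^sup>2 + 1)}" "N - 2"]
  by (simp add: conj_commute)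

lemma potential_drift:
  assumes N: "N \<ge> 2" and y: "y \<in> gap_space N"
  shows "(\<integral>\<^sup>+z. potential N z \<partial>measure_pmf (gap_kernel N y)) + 1
    \<le> potential N y + ennreal (real N ^ 2 + 1) * indicator (small_gaps N) y"
proof -
  obtain c where c: "c \<in> configs N" "gaps c = y" using gaps_surj[OF N y] by blast
  note len = configsD(1)[OF c(1)]
  define P where "P = real (card (pairs N))"
  have P: "P > 0" using finite_pairs pairs_nonempty[OF N] by (simp add: P_def card_gt_0_iff)
  have "(\<integral>\<^sup>+z. potential N z \<partial>measure_pmf (gap_kernel N y))
      = (\<integral>\<^sup>+p. potential N (gaps (step p c)) \<partial>measure_pmf (selection_pmf N))"
    using gap_kernel_gaps[OF N c(1)] c(2) by simp
  also have "\<dots> = (\<Sum>p\<in>pairs N. potential N (gaps (step p c))) / ennreal P"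
    unfolding selection_pmf_pairs P_def
    by (simp add: nn_integral_pmf_of_set finite_pairs pairs_nonempty[OF N] ennreal_of_nat_eq_real_of_nat)
  also have "(\<Sum>p\<in>pairs N. potential N (gaps (step p c))) = (\<Sum>p\<in>pairs N. ennreal (of_int (spread (step p c))))"
    using step_configs[OF c(1)] by (intro sum.cong) (auto simp: potential_gaps)
  also have "\<dots> = ennreal (of_int (\<Sum>p\<in>pairs N. spread (step p c)))"
    by (subst sum_ennreal) (auto simp: spread_nonneg)
  also have "\<dots> / ennreal P = ennreal (of_int (\<Sum>p\<in>pairs N. spread (step p c)) / P)"
    using P by (intro divide_ennreal) (auto simp: sum_nonneg spread_nonneg)
  finally have eq: "(\<integral>\<^sup>+z. potential N z \<partial>measure_pmf (gap_kernel N y)) + 1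
      = ennreal (of_int (\<Sum>p\<in>pairs N. spread (step p c)) / P + 1)"
    using P by (simp add: sum_nonneg spread_nonneg)
  have "real_of_int (\<Sum>p\<in>pairs N. spread (step p c))
      \<le> of_int (int (card (pairs N)) * (spread c + int N ^ 2) - 2 * dispersion c)"
    using sum_spread_step_le[OF len] by (simp only: of_int_le_iff)
  also have "\<dots> = P * (of_int (spread c) + real N ^ 2) - 2 * of_int (dispersion c)"
    by (simp add: P_def)
  finally have le: "of_int (\<Sum>p\<in>pairs N. spread (step p c)) / P
      \<le> of_int (spread c) + real N ^ 2 - 2 * of_int (dispersion c) / P"
    using P by (simp add: field_simps)
  have disp: "0 \<le> dispersion c" by (simp add: dispersion_def sum_nonneg)
  have "of_int (\<Sum>p\<in>pairs N. spread (step p c)) / P + 1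
      \<le> of_int (spread c) + (real N ^ 2 + 1) * indicator (small_gaps N) y"
  proof (cases "y \<in> small_gaps N")
    case True
    have "0 \<le> 2 * of_int (dispersion c) / P" using P disp by simp
    then show ?thesis using True le by simp
  next
    case False
    then have "\<not> set y \<subseteq> {..card (pairs N) * (N\<^sup>2 + 1)}"
      using y unfolding small_gaps_def gap_space_def by blast
    then obtain g where "g \<in> set y" "g > card (pairs N) * (N\<^sup>2 + 1)"
      unfolding subset_iff atMost_iff not_le[symmetric] by blast
    then obtain k where k: "k < N - 2" "gaps c ! k > card (pairs N) * (N\<^sup>2 + 1)"
      using c(2) len by (auto simp: in_set_conv_nth length_gaps)
    then have "int (card (pairs N) * (N\<^sup>2 + 1)) \<le> dispersion c"
      using gap_le_dispersion[of k c] len by linarith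
    then have "real_of_int (int (card (pairs N) * (N\<^sup>2 + 1))) \<le> of_int (dispersion c)"
      by (simp only: of_int_le_iff)
    then have "P * (real N ^ 2 + 1) \<le> 2 * of_int (dispersion c)" using disp by (simp add: P_def distrib_left)
    then have "real N ^ 2 + 1 \<le> 2 * of_int (dispersion c) / P" using P by (simp add: field_simps)
    then show ?thesis using False le by simp
  qed
  then have "ennreal (of_int (\<Sum>p\<in>pairs N. spread (step p c)) / P + 1)
      \<le> ennreal (of_int (spread c) + (real N ^ 2 + 1) * indicator (small_gaps N) y)"
    by (rule ennreal_leI)
  also have "\<dots> = potential N y + ennreal (real N ^ 2 + 1) * indicator (small_gaps N) y"
    using potential_gaps[OF c(1)] c(2)
    by (simp add: ennreal_plus spread_nonneg ennreal_mult ennreal_indicator)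
  finally show ?thesis using eq by simp
qed

lemma gap_taboo_supersolution:
  assumes N: "N \<ge> 2" and x: "x \<in> gap_space N"
  obtains W :: "nat list \<Rightarrow> ennreal" where "\<And>y. W y < \<infinity>"
    and "\<And>y. y \<in> gap_space N \<Longrightarrow>
      1 + (\<integral>\<^sup>+z. indicator (- {x}) z * W z \<partial>measure_pmf (gap_kernel N y)) \<le> W y"
proof (rule taboo_supersolution[of "small_gaps N" "potential N" _ "gap_space N" "gap_kernel N" x])
  show "potential N y < \<infinity>" for y by (simp add: potential_def)
  show "ennreal (real N ^ 2 + 1) < \<infinity>" by simp
  show "(y, x) \<in> (transitions (gap_kernel N))\<^sup>+" if "y \<in> small_gaps N" for y
    using gap_moves_irreducible[OF N x, of y] that trancl_mono[OF _ gap_moves_transitions[OF N]]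
    by (auto simp: small_gaps_def gap_space_def)
qed (use potential_drift[OF N] finite_small_gaps that in auto)

section \<open>Markov property by first-step decomposition\<close>

lemma space_selections [simp]: "space (selections N) = UNIV"
  by (simp add: selections_def space_PiM PiE_UNIV_domain)

lemma prob_space_selections: "prob_space (selections N)"
  unfolding selections_def by (intro prob_space_PiM measure_pmf.prob_space_axioms)

text \<open>An i.i.d. sequence has the law of a fresh selection put in front of an independent copy
  of the sequence.\<close>

lemma nn_integral_selections_Suc:
  assumes f: "f \<in> borel_measurable (selections N)"
  shows "(\<integral>\<^sup>+\<omega>. f \<omega> \<partial>selections N)
    = (\<integral>\<^sup>+p. \<integral>\<^sup>+\<omega>. f (case_nat p \<omega>) \<partial>selections N \<partial>measure_pmf (selection_pmf N))"
proof -
  interpret sequence_space "measure_pmf (selection_pmf N)"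
    by unfold_locales
  have S: "S = selections N" by (simp add: selections_def)
  interpret sel: prob_space "selections N" by (rule prob_space_selections)
  have m: "(\<lambda>(p, \<omega>). case_nat p \<omega>) \<in> measure_pmf (selection_pmf N) \<Otimes>\<^sub>M S \<rightarrow>\<^sub>M S"
    by measurable
  have "(\<integral>\<^sup>+\<omega>. f \<omega> \<partial>selections N)
      = (\<integral>\<^sup>+\<omega>. f \<omega> \<partial>distr (measure_pmf (selection_pmf N) \<Otimes>\<^sub>M S) S (\<lambda>(p, \<omega>). case_nat p \<omega>))"
    by (simp only: PiM_iter[unfolded S] S)
  also have "\<dots> = (\<integral>\<^sup>+z. f (case z of (p, \<omega>) \<Rightarrow> case_nat p \<omega>) \<partial>(measure_pmf (selection_pmf N) \<Otimes>\<^sub>M S))"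
    using f by (intro nn_integral_distr[OF m]) (simp add: S)
  also have "\<dots> = (\<integral>\<^sup>+p. \<integral>\<^sup>+\<omega>. f (case_nat p \<omega>) \<partial>selections N \<partial>measure_pmf (selection_pmf N))"
    using measurable_compose[OF m, of f borel] f unfolding S
    by (subst sel.nn_integral_fst[symmetric]) auto
  finally show ?thesis .
qed

lemma emeasure_selections_Suc:
  assumes A: "{\<omega>. A \<omega>} \<in> sets (selections N)"
  shows "emeasure (selections N) {\<omega>. A \<omega>}
    = (\<integral>\<^sup>+p. emeasure (selections N) {\<omega>. A (case_nat p \<omega>)} \<partial>measure_pmf (selection_pmf N))"
proof -
  have m: "case_nat p \<in> selections N \<rightarrow>\<^sub>M selections N" for p
    unfolding selections_def by measurable
  have "emeasure (selections N) {\<omega>. A \<omega>} = (\<integral>\<^sup>+\<omega>. indicator {\<omega>. A \<omega>} \<omega> \<partial>selections N)"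
    using A by simp
  also have "\<dots> = (\<integral>\<^sup>+p. \<integral>\<^sup>+\<omega>. indicator {\<omega>. A \<omega>} (case_nat p \<omega>) \<partial>selections N \<partial>measure_pmf (selection_pmf N))"
    using A by (intro nn_integral_selections_Suc) simp
  also have "\<dots> = (\<integral>\<^sup>+p. emeasure (selections N) {\<omega>. A (case_nat p \<omega>)} \<partial>measure_pmf (selection_pmf N))"
  proof (intro nn_integral_cong)
    fix p
    have "{\<omega>. A (case_nat p \<omega>)} \<in> sets (selections N)"
      using measurable_sets[OF m A, of p] by (simp add: vimage_def)
    moreover have "(\<lambda>\<omega>. indicator {\<omega>. A \<omega>} (case_nat p \<omega>)) = indicator {\<omega>. A (case_nat p \<omega>)}"
      by (auto split: split_indicator)
    ultimately show "(\<integral>\<^sup>+\<omega>. indicator {\<omega>. A \<omega>} (case_nat p \<omega>) \<partial>selections N)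
        = emeasure (selections N) {\<omega>. A (case_nat p \<omega>)}"
      by (metis nn_integral_indicator)
  qed
  finally show ?thesis .
qed

lemma measurable_counters [measurable]: "counters c t \<in> selections N \<rightarrow>\<^sub>M count_space UNIV"
proof (induction t)
  case (Suc t)
  have "(\<lambda>\<omega>. \<omega> t) \<in> selections N \<rightarrow>\<^sub>M count_space UNIV"
    unfolding selections_def
    by (rule measurable_compose[OF measurable_component_singleton[of t]]) auto
  moreover have "(\<lambda>\<omega>. step p (counters c t \<omega>)) \<in> selections N \<rightarrow>\<^sub>M count_space UNIV" for p
    by (rule measurable_compose[OF Suc]) simp
  ultimately have "(\<lambda>\<omega>. step (\<omega> t) (counters c t \<omega>)) \<in> selections N \<rightarrow>\<^sub>M count_space UNIV"
    by (rule measurable_compose_countable[rotated])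
  then show ?case by simp
qed simp

lemma measurable_gap_process [measurable]: "gap_process c t \<in> selections N \<rightarrow>\<^sub>M count_space UNIV"
  unfolding gap_process_def by (rule measurable_compose[OF measurable_counters]) simp

text \<open>\<open>counters\<close> recurses on the last selection; this peels off the first one, as
  the first-step decomposition requires.\<close>

lemma counters_case_nat: "counters c (Suc t) (case_nat p \<omega>) = counters (step p c) t \<omega>"
  by (induction t) auto

lemma gap_process_0: "gap_process c 0 \<omega> = gaps c"
  by (simp add: gap_process_def)

lemma gap_process_case_nat: "gap_process c (Suc t) (case_nat p \<omega>) = gap_process (step p c) t \<omega>"
  by (simp only: gap_process_def counters_case_nat)

lemma length_counters [simp]: "length (counters c t \<omega>) = length c"
  by (induction t) auto

text \<open>Steps preserve the length, so this holds for every \<open>\<omega>\<close>, also for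
  selections outside \<open>pairs N\<close>.\<close>

lemma gap_process_in_gap_space: "c \<in> configs N \<Longrightarrow> gap_process c t \<omega> \<in> gap_space N"
  by (simp add: gap_process_def gap_space_def length_gaps configs_def)

lemma AE_selection_configs:
  "N \<ge> 2 \<Longrightarrow> c \<in> configs N \<Longrightarrow> AE p in measure_pmf (selection_pmf N). step p c \<in> configs N"
  by (auto simp: AE_measure_pmf_iff set_selection_pmf intro: step_configs)

lemma sets_path [measurable]:
  "{\<omega>. \<forall>s\<le>t. gap_process c s \<omega> = x s} \<in> sets (selections N)"
  "{\<omega>. (\<forall>s\<le>t. gap_process c s \<omega> = x s) \<and> gap_process c (Suc t) \<omega> = y} \<in> sets (selections N)"
proof -
  have "{\<omega> \<in> space (selections N). \<forall>s\<le>t. gap_process c s \<omega> = x s} \<in> sets (selections N)"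
    "{\<omega> \<in> space (selections N). (\<forall>s\<le>t. gap_process c s \<omega> = x s) \<and> gap_process c (Suc t) \<omega> = y} \<in> sets (selections N)"
    by measurable
  then show "{\<omega>. \<forall>s\<le>t. gap_process c s \<omega> = x s} \<in> sets (selections N)"
    "{\<omega>. (\<forall>s\<le>t. gap_process c s \<omega> = x s) \<and> gap_process c (Suc t) \<omega> = y} \<in> sets (selections N)"
    by simp_all
qed

lemma all_le_Suc_split: "(\<forall>s\<le>Suc t. P s) \<longleftrightarrow> P 0 \<and> (\<forall>s\<le>t. P (Suc s))"
  by (metis Suc_le_mono le0 nat.exhaust)

text \<open>Induction on the first selection: afterwards the process restarts from
  \<open>step p c\<close> and has to follow the shifted path, while the last transition keeps its
  kernel factor. The product form covers paths of probability 0.\<close>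

lemma gap_process_markov:
  assumes N: "N \<ge> 2" and c: "c \<in> configs N"
  shows "emeasure (selections N) {\<omega>. (\<forall>s\<le>t. gap_process c s \<omega> = x s) \<and> gap_process c (Suc t) \<omega> = y}
    = emeasure (selections N) {\<omega>. \<forall>s\<le>t. gap_process c s \<omega> = x s} * pmf (gap_kernel N (x t)) y"
  using c
proof (induction t arbitrary: c x)
  case 0
  interpret prob_space "selections N" by (rule prob_space_selections)
  have 1: "emeasure (selections N) UNIV = 1" using emeasure_space_1 by simp
  have "emeasure (selections N) {\<omega>. (\<forall>s\<le>0. gap_process c s \<omega> = x s) \<and> gap_process c (Suc 0) \<omega> = y}
    = (\<integral>\<^sup>+p. emeasure (selections N) {\<omega>. gaps c = x 0 \<and> gaps (step p c) = y} \<partial>measure_pmf (selection_pmf N))"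
    using emeasure_selections_Suc[OF sets_path(2)[where t = 0]]
    by (simp add: gap_process_case_nat gap_process_0)
  also have "\<dots> = (\<integral>\<^sup>+p. of_bool (gaps c = x 0) * indicator ((\<lambda>p. gaps (step p c)) -` {y}) p \<partial>measure_pmf (selection_pmf N))"
    by (intro nn_integral_cong) (auto simp: 1)
  also have "\<dots> = of_bool (gaps c = x 0) * pmf (gap_kernel N (gaps c)) y"
    by (simp add: gap_kernel_gaps[OF N 0] pmf_map measure_pmf.emeasure_eq_measure nn_integral_cmult)
  also have "\<dots> = emeasure (selections N) {\<omega>. \<forall>s\<le>0. gap_process c s \<omega> = x s} * pmf (gap_kernel N (x 0)) y"
    by (auto simp: gap_process_0 1)
  finally show ?case .
next
  case (Suc t)
  have "emeasure (selections N) {\<omega>. (\<forall>s\<le>Suc t. gap_process c s \<omega> = x s) \<and> gap_process c (Suc (Suc t)) \<omega> = y}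
    = (\<integral>\<^sup>+p. of_bool (gaps c = x 0) * emeasure (selections N)
        {\<omega>. (\<forall>s\<le>t. gap_process (step p c) s \<omega> = x (Suc s)) \<and> gap_process (step p c) (Suc t) \<omega> = y}
      \<partial>measure_pmf (selection_pmf N))"
    by (subst emeasure_selections_Suc[OF sets_path(2)],
        unfold all_le_Suc_split gap_process_case_nat gap_process_0, intro nn_integral_cong) simp
  also have "\<dots> = (\<integral>\<^sup>+p. of_bool (gaps c = x 0) * emeasure (selections N)
        {\<omega>. \<forall>s\<le>t. gap_process (step p c) s \<omega> = x (Suc s)} * pmf (gap_kernel N (x (Suc t))) y
      \<partial>measure_pmf (selection_pmf N))"
    \<comment> \<open>The induction hypothesis needs an admissible configuration, which
      \<open>step p c\<close> is for almost every \<open>p\<close>.\<close>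
    by (rule nn_integral_cong_AE, rule AE_mp[OF AE_selection_configs[OF N Suc.prems]])
      (auto simp: Suc.IH mult.assoc)
  also have "\<dots> = (\<integral>\<^sup>+p. of_bool (gaps c = x 0) * emeasure (selections N)
        {\<omega>. \<forall>s\<le>t. gap_process (step p c) s \<omega> = x (Suc s)}
      \<partial>measure_pmf (selection_pmf N)) * pmf (gap_kernel N (x (Suc t))) y"
    by (rule nn_integral_multc) simp
  also have "(\<integral>\<^sup>+p. of_bool (gaps c = x 0) * emeasure (selections N)
        {\<omega>. \<forall>s\<le>t. gap_process (step p c) s \<omega> = x (Suc s)} \<partial>measure_pmf (selection_pmf N))
     = emeasure (selections N) {\<omega>. \<forall>s\<le>Suc t. gap_process c s \<omega> = x s}"
    by (subst emeasure_selections_Suc[OF sets_path(1)],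
        unfold all_le_Suc_split gap_process_case_nat gap_process_0, intro nn_integral_cong) simp
  finally show ?case .
qed

lemma markov_chain_gap_process:
  assumes N: "N \<ge> 2" and c: "c \<in> configs N"
  shows "markov_chain (selections N) (gap_space N) (gap_kernel N) (gap_process c)"
  unfolding markov_chain_def
proof (intro conjI allI ballI impI)
  interpret prob_space "selections N" by (rule prob_space_selections)
  show "prob_space (selections N)" by (rule prob_space_selections)
  show "countable (gap_space N)" by (rule countableI_type)
  show "gap_process c t \<in> selections N \<rightarrow>\<^sub>M count_space (gap_space N)" for t
    using measurable_sets[OF measurable_gap_process[of c t N]] gap_process_in_gap_space[OF c]
    by (subst measurable_count_space_eq2_countable) (auto intro: countableI_type)
  show "set_pmf (gap_kernel N y) \<subseteq> gap_space N" if "y \<in> gap_space N" for y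
    by (rule gap_kernel_closed[OF N that])
  fix t x y
  assume pos: "0 < \<P>(\<omega> in selections N. \<forall>s\<le>t. gap_process c s \<omega> = x s)"
  have "\<P>(\<omega> in selections N. gap_process c (Suc t) \<omega> = y \<and> (\<forall>s\<le>t. gap_process c s \<omega> = x s))
    = \<P>(\<omega> in selections N. \<forall>s\<le>t. gap_process c s \<omega> = x s) * pmf (gap_kernel N (x t)) y"
    using gap_process_markov[OF N c, of t x y]
    by (simp add: emeasure_eq_measure ennreal_mult'[symmetric] conj_commute)
  then show "\<P>(\<omega> in selections N. gap_process c (Suc t) \<omega> = y \<bar> \<forall>s\<le>t. gap_process c s \<omega> = x s)
      = pmf (gap_kernel N (x t)) y"
    using pos by (simp add: cond_prob_def)
qed

section \<open>Expected return times\<close>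

definition avoids :: "int list \<Rightarrow> nat list \<Rightarrow> nat \<Rightarrow> (nat \<Rightarrow> nat \<times> nat) \<Rightarrow> bool" where
  "avoids c x k \<omega> \<longleftrightarrow> (\<forall>s\<in>{1..k}. gap_process c s \<omega> \<noteq> x)"

text \<open>For the return time T this is min(T, n), written as the sum of the indicators of T > k
  over k < n.\<close>

definition truncated_return_time :: "int list \<Rightarrow> nat list \<Rightarrow> nat \<Rightarrow> (nat \<Rightarrow> nat \<times> nat) \<Rightarrow> ennreal" where
  "truncated_return_time c x n \<omega> = (\<Sum>k<n. of_bool (avoids c x k \<omega>))"

lemma measurable_truncated_return_time [measurable]:
  "truncated_return_time c x n \<in> borel_measurable (selections N)"
  unfolding truncated_return_time_def avoids_def of_bool_def by measurable

text \<open>The term k = 0 is always 1, avoidance over no steps being vacuous; the other terms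
  restart after the first move unless it has reached \<open>x\<close>.\<close>

lemma truncated_return_time_Suc:
  "truncated_return_time c x (Suc n) (case_nat p \<omega>)
    = 1 + indicator (- {x}) (gaps (step p c)) * truncated_return_time (step p c) x n \<omega>"
proof -
  have *: "(\<forall>s\<in>{1..Suc k}. P s) \<longleftrightarrow> P 1 \<and> (\<forall>s\<in>{1..k}. P (Suc s))" for k and P :: "nat \<Rightarrow> bool"
  proof (intro iffI conjI ballI)
    fix s assume "P 1 \<and> (\<forall>s\<in>{1..k}. P (Suc s))" "s \<in> {1..Suc k}"
    then show "P s" by (cases s; cases "s = 1") auto
  qed auto
  have "avoids c x (Suc k) (case_nat p \<omega>) \<longleftrightarrow> gaps (step p c) \<noteq> x \<and> avoids (step p c) x k \<omega>" for k
    unfolding avoids_def * by (simp add: gap_process_case_nat gap_process_0)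
  then show ?thesis
    unfolding truncated_return_time_def
    by (subst sum.lessThan_Suc_shift) (auto simp: avoids_def sum_distrib_left split: split_indicator)
qed

text \<open>Truncation at the first return already attains the return time; without a return the
  truncations equal \<open>n\<close> and the supremum is infinite.\<close>

lemma return_time_le: "return_time (gap_process c) x \<omega> \<le> (SUP n. truncated_return_time c x n \<omega>)"
proof (cases "\<exists>t\<ge>1. gap_process c t \<omega> = x")
  case True
  define t where "t = (LEAST t. 1 \<le> t \<and> gap_process c t \<omega> = x)"
  have t: "1 \<le> t \<and> gap_process c t \<omega> = x" unfolding t_def by (rule LeastI_ex) (use True in blast)
  have "avoids c x k \<omega>" if "k < t" for k
    unfolding avoids_def
  proof
    fix s assume s: "s \<in> {1..k}"
    then have "s < t" using that by simp
    then have "\<not> (1 \<le> s \<and> gap_process c s \<omega> = x)" unfolding t_def by (rule not_less_Least)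
    then show "gap_process c s \<omega> \<noteq> x" using s by simp
  qed
  then have "truncated_return_time c x t \<omega> = of_nat t" by (simp add: truncated_return_time_def)
  moreover have "return_time (gap_process c) x \<omega> \<le> of_nat t"
    unfolding return_time_def using t by (intro INF_lower) simp
  ultimately show ?thesis
    using SUP_upper[of t UNIV "\<lambda>n. truncated_return_time c x n \<omega>"] by simp
next
  case False
  then have "avoids c x k \<omega>" for k by (auto simp: avoids_def)
  then have "truncated_return_time c x n \<omega> = of_nat n" for n by (simp add: truncated_return_time_def)
  then show ?thesis by (simp add: ennreal_SUP_of_nat_eq_top)
qed

text \<open>The first-step recursion has the shape of the supersolution inequality, so the bound by
  \<open>W\<close> propagates from the trivial truncation at 0.\<close>

lemma nn_integral_truncated_return_time_le:
  assumes N: "N \<ge> 2" and c: "c \<in> configs N"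
    and W: "\<And>y. y \<in> gap_space N \<Longrightarrow>
      1 + (\<integral>\<^sup>+z. indicator (- {x}) z * W z \<partial>measure_pmf (gap_kernel N y)) \<le> W y"
  shows "(\<integral>\<^sup>+\<omega>. truncated_return_time c x n \<omega> \<partial>selections N) \<le> W (gaps c)"
  using c
proof (induction n arbitrary: c)
  case (Suc n)
  interpret prob_space "selections N" by (rule prob_space_selections)
  have 1: "emeasure (selections N) UNIV = 1" using emeasure_space_1 by simp
  have "(\<integral>\<^sup>+\<omega>. truncated_return_time c x (Suc n) \<omega> \<partial>selections N)
    = (\<integral>\<^sup>+p. 1 + indicator (- {x}) (gaps (step p c)) *
        (\<integral>\<^sup>+\<omega>. truncated_return_time (step p c) x n \<omega> \<partial>selections N) \<partial>measure_pmf (selection_pmf N))"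
    by (simp add: nn_integral_selections_Suc truncated_return_time_Suc nn_integral_add nn_integral_cmult 1)
  also have "\<dots> \<le> (\<integral>\<^sup>+p. 1 + indicator (- {x}) (gaps (step p c)) * W (gaps (step p c))
      \<partial>measure_pmf (selection_pmf N))"
    by (rule nn_integral_mono_AE, rule AE_mp[OF AE_selection_configs[OF N Suc.prems]])
      (auto intro!: mult_left_mono Suc.IH)
  also have "\<dots> = 1 + (\<integral>\<^sup>+z. indicator (- {x}) z * W z \<partial>measure_pmf (gap_kernel N (gaps c)))"
    by (simp add: nn_integral_add gap_kernel_gaps[OF N Suc.prems])
  also have "\<dots> \<le> W (gaps c)" by (rule W[OF gaps_in_gap_space[OF Suc.prems]])
  finally show ?case .
next
  case 0
  have "truncated_return_time c x 0 = (\<lambda>_. 0)" by (simp add: truncated_return_time_def fun_eq_iff)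
  then show ?case by simp
qed

lemma positive_recurrent_gap_process:
  assumes N: "N \<ge> 2" and c: "c \<in> configs N" and x: "x \<in> gap_space N"
  shows "positive_recurrent_at (selections N) (gap_process c) x"
proof -
  obtain W where fin: "\<And>y. W y < \<infinity>" and W: "\<And>y. y \<in> gap_space N \<Longrightarrow>
      1 + (\<integral>\<^sup>+z. indicator (- {x}) z * W z \<partial>measure_pmf (gap_kernel N y)) \<le> W y"
    using gap_taboo_supersolution[OF N x] by blast
  have "(\<integral>\<^sup>+\<omega>. return_time (gap_process c) x \<omega> \<partial>selections N)
      \<le> (\<integral>\<^sup>+\<omega>. (SUP n. truncated_return_time c x n \<omega>) \<partial>selections N)"
    by (intro nn_integral_mono return_time_le)
  also have "\<dots> = (SUP n. \<integral>\<^sup>+\<omega>. truncated_return_time c x n \<omega> \<partial>selections N)"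
    by (intro nn_integral_monotone_convergence_SUP measurable_truncated_return_time incseq_SucI le_funI)
      (simp add: truncated_return_time_def)
  also have "\<dots> \<le> W (gaps c)"
    by (intro SUP_least nn_integral_truncated_return_time_le[OF N c W])
  also have "\<dots> < \<infinity>" by (rule fin)
  finally show ?thesis by (simp add: positive_recurrent_at_def)
qed

theorem theorem1:
  fixes N :: nat
  assumes "N \<ge> 3"
  shows "\<exists>K :: nat list \<Rightarrow> nat list pmf.
    (\<forall>c\<in>configs N. markov_chain (selections N) (gap_space N) K (gap_process c)) \<and>
    (\<forall>x\<in>gap_space N. \<forall>c\<in>configs N. gaps c = x \<longrightarrow>
       positive_recurrent_at (selections N) (gap_process c) x) \<and>
    (\<exists>\<pi>. stationary_distribution (gap_space N) K \<pi>)"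
proof (intro exI[of _ "gap_kernel N"] conjI ballI impI)
  have N: "N \<ge> 2" using assms by simp
  show "markov_chain (selections N) (gap_space N) (gap_kernel N) (gap_process c)"
    if "c \<in> configs N" for c
    by (rule markov_chain_gap_process[OF N that])
  show "positive_recurrent_at (selections N) (gap_process c) x"
    if "x \<in> gap_space N" "c \<in> configs N" for x c
    by (rule positive_recurrent_gap_process[OF N that(2,1)])
  \<comment> \<open>Any state can serve as the base point of the excursions; the zero gap vector is
    a concrete one.\<close>
  define x where "x = replicate (N - 2) (0::nat)"
  have x: "x \<in> gap_space N" by (simp add: x_def gap_space_def)
  obtain W where fin: "\<And>y. W y < \<infinity>" and W: "\<And>y. y \<in> gap_space N \<Longrightarrow>
      1 + (\<integral>\<^sup>+z. indicator (- {x}) z * W z \<partial>measure_pmf (gap_kernel N y)) \<le> W y"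
    using gap_taboo_supersolution[OF N x] by blast
  show "\<exists>\<pi>. stationary_distribution (gap_space N) (gap_kernel N) \<pi>"
    by (rule stationary_distribution_exists[OF x gap_kernel_closed[OF N] fin W])
qed

end
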